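(* Let $\mathbf X$ be a one-dimensional quasi-geometric rough path. Then for all $m,n\ge1$ $$\langle\pi(\mathscr r_m)^{\top n},\mathbf X_{s,t}\rangle=(-1)^n\sum_{a_1+2a_2+\cdots+na_n=n}\frac{(-1)^{a_1+\cdots+a_n}}{a_1!\cdot2^{a_2}a_2!\cdots n^{a_n}a_n!}\,\langle\pi(\mathscr r_m),\mathbf X_{s,t}\rangle^{a_1}\langle\pi(\mathscr r_{2m}),\mathbf X_{s,t}\rangle^{a_2}\cdots\langle\pi(\mathscr r_{mn}),\mathbf X_{s,t}\rangle^{a_n},$$ the sum being over non-negative integers $a_1,\ldots,a_n$.
   Context: $\mathcal H_{\mathrm{CK}}$ is the undecorated Connes–Kreimer Hopf algebra, spanned by non-planar rooted forests, with disjoint union product and $\Delta_{\mathrm{CK}}f=\sum_Af|_A\otimes f|_{A^c}$, over vertex subsets $A$ closed under passing to descendants (upper part on the left); $\mathbf 1$ is the empty forest, $|f|$ the number of vertices, $\mathscr r_m$ the forest of $m$ single vertices, $\mathcal P$ the space of primitives. Natural growth $\top$ is bilinear with $f\top\mathbf 1=f=\mathbf 1\top f$ and $f\top g=\frac1{|g|}\sum_v(\text{graft all roots of }f\text{ onto }v\in g)$ for non-empty forests; $p^{\top n}$ is the $n$-fold iterate bracketed from the left. $p_1\otimes\cdots\otimes p_n\mapsto p_1\top\cdots\top p_n$ is a coalgebra isomorphism $\bigotimes(\mathcal P)\to\mathcal H_{\mathrm{CK}}$ (deconcatenation on the left), and $\pi\colon\mathcal H_{\mathrm{CK}}\to\mathcal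 P$ is the corresponding projection onto words of length one. A one-dimensional $\rho$-branched rough path assigns to $0\le s\le t\le T$ a linear functional $\langle\cdot,\mathbf X_{s,t}\rangle$ on forests of weight $\le\lfloor\rho\rfloor$ that is multiplicative for the forest product with $\langle\mathbf 1,\mathbf X_{s,t}\rangle=1$, satisfies $\langle h,\mathbf X_{s,t}\rangle=\langle\Delta_{\mathrm{CK}}h,\mathbf X_{s,u}\otimes\mathbf X_{u,t}\rangle$, and $|\langle f,\mathbf X_{s,t}\rangle|=O(\omega(s,t)^{|f|/\rho})$ for a control $\omega$ (continuous, superadditive, zero on the diagonal). It extends uniquely to a multiplicative functional with the same properties on all of $\mathcal H_{\mathrm{CK}}$ (its signature), also denoted $\mathbf X$. It is quasi-geometric if it factors through the Hopf algebra morphism $\widetilde{\mathfrak a}\colon\mathcal H_{\mathrm{CK}}\to\mathrm{QSh}(\mathbb R)$ determined by $\widetilde{\mathfrak a}([f])=\widetilde{\mathfrak a}(f)\otimes x$, where $[f]$ joins the roots of $f$ to a new root and $\mathrm{QSh}(\mathbb R)$ is the quasi-shuffle Hopf algebra on words in the letters $x,x^2,x^3,\ldots$ with deconcatenation and $(wa)*(vb)=(w*vb)a+(wa*v)b+(w*v)(ab)$; equivalently $\langle p_1\top\cdots\top p_n,\mathbf X\rangle=0$ whenever some $p_k\in\mathcal P$ lies in the span of the $\pi(f)$ with $f$ having at least one edge. *)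

theory Defs
  imports "HOL-Analysis.Analysis" "HOL-Analysis.Finite_Function_Topology"
    "HOL-Library.Multiset" "HOL-Library.FuncSet"
begin

section \<open>Free vector spaces\<close>

text \<open>The real vector space with basis \<open>'k\<close> is the type of finitely supported functions
  \<open>'k \<Rightarrow>\<^sub>0 real\<close>; a linear map out of it is given by its values on the basis and applied
  through \<open>lin_ext\<close>. The tensor product of the spaces with bases \<open>'k\<close> and \<open>'l\<close> is the space
  with basis \<open>'k \<times> 'l\<close>.\<close>

abbreviation basis :: "'k \<Rightarrow> ('k \<Rightarrow>\<^sub>0 real)" where
  "basis k \<equiv> Poly_Mapping.single k 1"

definition lin_ext :: "('k \<Rightarrow> 'v::real_vector) \<Rightarrow> ('k \<Rightarrow>\<^sub>0 real) \<Rightarrow> 'v" where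
  "lin_ext \<phi> p = (\<Sum>k\<in>Poly_Mapping.keys p. Poly_Mapping.lookup p k *\<^sub>R \<phi> k)"

definition bilin_ext ::
    "('k \<Rightarrow> 'l \<Rightarrow> 'v::real_vector) \<Rightarrow> ('k \<Rightarrow>\<^sub>0 real) \<Rightarrow> ('l \<Rightarrow>\<^sub>0 real) \<Rightarrow> 'v" where
  "bilin_ext \<beta> p q = lin_ext (\<lambda>k. lin_ext (\<beta> k) q) p"

definition tensor :: "('k \<Rightarrow>\<^sub>0 real) \<Rightarrow> ('l \<Rightarrow>\<^sub>0 real) \<Rightarrow> ('k \<times> 'l \<Rightarrow>\<^sub>0 real)" where
  "tensor = bilin_ext (\<lambda>k l. basis (k, l))"

section \<open>Non-planar rooted forests\<close>

datatype rtree = Node (branches: "rtree multiset")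

type_synonym forest = "rtree multiset"

text \<open>A vertex of a forest is addressed by the path leading to it from a root: the pair
  \<open>(t, i)\<close> with \<open>i < count F t\<close> selects the \<open>i\<close>-th copy of the tree \<open>t\<close> in \<open>F\<close>, and the
  remainder of the path is a path in the forest of branches of \<open>t\<close>. The empty path is not a
  vertex.\<close>

type_synonym address = "(rtree \<times> nat) list"

primrec is_path :: "forest \<Rightarrow> address \<Rightarrow> bool" where
  "is_path F [] \<longleftrightarrow> True"
| "is_path F (x # p) \<longleftrightarrow> snd x < count F (fst x) \<and> is_path (branches (fst x)) p"

definition vertices :: "forest \<Rightarrow> address set" where
  "vertices F = {p. p \<noteq> [] \<and> is_path F p}"

definition weight :: "forest \<Rightarrow> nat" where
  "weight F = card (vertices F)"

definition descendant_closed :: "forest \<Rightarrow> address set \<Rightarrow> bool" where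
  "descendant_closed F A \<longleftrightarrow> A \<subseteq> vertices F \<and> (\<forall>p\<in>A. \<forall>q. p @ q \<in> vertices F \<longrightarrow> p @ q \<in> A)"

lemma size_branches_less: "t \<in># F \<Longrightarrow> size t < size (Node F)"
  by (induction F) auto

text \<open>The forest induced on the vertices in \<open>A\<close>: the order of ancestry is restricted to \<open>A\<close>,
  so that the components below a vertex outside \<open>A\<close> are not attached to it any more.\<close>

function restrict_forest :: "forest \<Rightarrow> address set \<Rightarrow> forest" where
  "restrict_forest F A =
     (\<Sum>t\<in>set_mset F. \<Sum>i<count F t.
        let G = restrict_forest (branches t) {q. (t, i) # q \<in> A}
        in if [(t, i)] \<in> A then {#Node G#} else G)"
  by pat_completeness auto
termination
proof (relation "Wellfounded.measure (\<lambda>(F, A). size (Node F))")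
  fix F :: forest and A :: "address set" and t i
  assume "t \<in> set_mset F"
  then show "((branches t, {q. (t, i) # q \<in> A}), (F, A)) \<in> Wellfounded.measure (\<lambda>(F, A). size (Node F))"
    using size_branches_less[of t F] by (cases t) simp
qed simp

declare restrict_forest.simps [simp del]

text \<open>The forest \<open>f\<close> is grafted onto the vertex with the given address; at the empty address it
  is put beside the other trees.\<close>

primrec graft :: "forest \<Rightarrow> address \<Rightarrow> forest \<Rightarrow> forest" where
  "graft f [] G = G + f"
| "graft f (x # p) G = G - {#fst x#} + {#Node (graft f p (branches (fst x)))#}"

section \<open>The Connes-Kreimer Hopf algebra and natural growth\<close>

type_synonym ck = "forest \<Rightarrow>\<^sub>0 real"

definition ck_coproduct :: "forest \<Rightarrow> (forest \<times> forest \<Rightarrow>\<^sub>0 real)" where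
  "ck_coproduct F =
     (\<Sum>A | descendant_closed F A.
        basis (restrict_forest F A, restrict_forest F (vertices F - A)))"

definition primitives :: "ck set" where
  "primitives = {p. lin_ext ck_coproduct p = tensor p (basis {#}) + tensor (basis {#}) p}"

definition growth_forest :: "forest \<Rightarrow> forest \<Rightarrow> ck" where
  "growth_forest f g =
     (if g = {#} then basis f
      else if f = {#} then basis g
      else (1 / real (weight g)) *\<^sub>R (\<Sum>v\<in>vertices g. basis (graft f v g)))"

definition natural_growth :: "ck \<Rightarrow> ck \<Rightarrow> ck" (infixl \<open>\<^bold>\<top>\<close> 70) where
  "natural_growth = bilin_ext growth_forest"

definition growth_word :: "ck list \<Rightarrow> ck" where
  "growth_word ps = foldl natural_growth (basis {#}) ps"

definition growth_power :: "ck \<Rightarrow> nat \<Rightarrow> ck" where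
  "growth_power p n = growth_word (replicate n p)"

text \<open>The words \<open>p\<^sub>1 \<^bold>\<top> \<dots> \<^bold>\<top> p\<^sub>n\<close> in primitive elements are the images of
  \<open>p\<^sub>1 \<otimes> \<dots> \<otimes> p\<^sub>n\<close> under a linear isomorphism from the tensor coalgebra over the primitives;
  hence they span, and exactly one linear map has the prescribed values on them.\<close>

definition is_word_projection :: "(forest \<Rightarrow> ck) \<Rightarrow> bool" where
  "is_word_projection \<phi> \<longleftrightarrow>
     (\<forall>ps. set ps \<subseteq> primitives \<longrightarrow>
        lin_ext \<phi> (growth_word ps) = (if length ps = 1 then hd ps else 0))"

definition prim_proj :: "forest \<Rightarrow> ck" where
  "prim_proj = (THE \<phi>. is_word_projection \<phi>)"

definition isolated_vertices :: "nat \<Rightarrow> forest" where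
  "isolated_vertices m = replicate_mset m (Node {#})"

section \<open>The quasi-shuffle Hopf algebra and arborification\<close>

text \<open>\<open>PowSuc k\<close> is the letter \<open>x^(k+1)\<close>.\<close>

datatype letter = PowSuc nat

primrec letter_exponent :: "letter \<Rightarrow> nat" where
  "letter_exponent (PowSuc k) = Suc k"

definition letter_mult :: "letter \<Rightarrow> letter \<Rightarrow> letter" where
  "letter_mult a b = PowSuc (letter_exponent a + letter_exponent b - 1)"

type_synonym qsh = "letter list \<Rightarrow>\<^sub>0 real"

definition append_letter :: "qsh \<Rightarrow> letter \<Rightarrow> qsh" where
  "append_letter p a = lin_ext (\<lambda>w. basis (w @ [a])) p"

function quasi_shuffle :: "letter list \<Rightarrow> letter list \<Rightarrow> qsh" where
  "quasi_shuffle u z =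
     (if u = [] then basis z
      else if z = [] then basis u
      else append_letter (quasi_shuffle (butlast u) z) (last u)
         + append_letter (quasi_shuffle u (butlast z)) (last z)
         + append_letter (quasi_shuffle (butlast u) (butlast z)) (letter_mult (last u) (last z)))"
  by pat_completeness auto
termination
  by (relation "Wellfounded.measure (\<lambda>(u, z). length u + length z)")
     (auto simp: neq_Nil_conv)

declare quasi_shuffle.simps [simp del]

definition deconcatenation :: "letter list \<Rightarrow> (letter list \<times> letter list \<Rightarrow>\<^sub>0 real)" where
  "deconcatenation w = (\<Sum>i\<le>length w. basis (take i w, drop i w))"

text \<open>A morphism of bialgebras between Hopf algebras respects the antipodes.\<close>

definition ck_qsh_hopf_morphism :: "(forest \<Rightarrow> qsh) \<Rightarrow> bool" where
  "ck_qsh_hopf_morphism \<alpha> \<longleftrightarrow>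
     \<alpha> {#} = basis []
     \<and> (\<forall>f g. \<alpha> (f + g) = bilin_ext quasi_shuffle (\<alpha> f) (\<alpha> g))
     \<and> (\<forall>f. Poly_Mapping.lookup (\<alpha> f) [] = (if f = {#} then 1 else 0))
     \<and> (\<forall>f. lin_ext deconcatenation (\<alpha> f)
            = lin_ext (\<lambda>(g, h). tensor (\<alpha> g) (\<alpha> h)) (ck_coproduct f))"

definition arborification :: "forest \<Rightarrow> qsh" where
  "arborification =
     (THE \<alpha>. ck_qsh_hopf_morphism \<alpha>
        \<and> (\<forall>f. \<alpha> {#Node f#} = append_letter (\<alpha> f) (PowSuc 0)))"

section \<open>Branched rough paths\<close>

definition control :: "real \<Rightarrow> (real \<Rightarrow> real \<Rightarrow> real) \<Rightarrow> bool" where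
  "control T \<omega> \<longleftrightarrow>
     continuous_on {(s, t). 0 \<le> s \<and> s \<le> t \<and> t \<le> T} (\<lambda>(s, t). \<omega> s t)
     \<and> (\<forall>s t. 0 \<le> s \<and> s \<le> t \<and> t \<le> T \<longrightarrow> 0 \<le> \<omega> s t)
     \<and> (\<forall>t. 0 \<le> t \<and> t \<le> T \<longrightarrow> \<omega> t t = 0)
     \<and> (\<forall>s u t. 0 \<le> s \<and> s \<le> u \<and> u \<le> t \<and> t \<le> T \<longrightarrow> \<omega> s u + \<omega> u t \<le> \<omega> s t)"

text \<open>\<open>W\<close> is the set of forests on which the functionals are considered; their values outside
  \<open>W\<close> are irrelevant. The growth bound is vacuous for the empty forest, which has to be left out
  because \<open>0 powr 0 = 0\<close>.\<close>

definition rough_on ::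
    "forest set \<Rightarrow> real \<Rightarrow> real \<Rightarrow> (real \<Rightarrow> real \<Rightarrow> real) \<Rightarrow> (real \<Rightarrow> real \<Rightarrow> forest \<Rightarrow> real) \<Rightarrow> bool"
  where
  "rough_on W \<rho> T \<omega> X \<longleftrightarrow>
     (\<forall>s t. 0 \<le> s \<and> s \<le> t \<and> t \<le> T \<longrightarrow>
        X s t {#} = 1 \<and> (\<forall>f g. f + g \<in> W \<longrightarrow> X s t (f + g) = X s t f * X s t g))
     \<and> (\<forall>s u t. 0 \<le> s \<and> s \<le> u \<and> u \<le> t \<and> t \<le> T \<longrightarrow>
        (\<forall>h\<in>W. X s t h = lin_ext (\<lambda>(f, g). X s u f * X u t g) (ck_coproduct h)))
     \<and> (\<forall>f\<in>W - {{#}}. \<exists>C. \<forall>s t. 0 \<le> s \<and> s \<le> t \<and> t \<le> T \<longrightarrow>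
        \<bar>X s t f\<bar> \<le> C * \<omega> s t powr (real (weight f) / \<rho>))"

definition branched_rough_path ::
    "real \<Rightarrow> real \<Rightarrow> (real \<Rightarrow> real \<Rightarrow> real) \<Rightarrow> (real \<Rightarrow> real \<Rightarrow> forest \<Rightarrow> real) \<Rightarrow> bool" where
  "branched_rough_path \<rho> T \<omega> X \<longleftrightarrow>
     0 < \<rho> \<and> control T \<omega> \<and> rough_on {f. int (weight f) \<le> \<lfloor>\<rho>\<rfloor>} \<rho> T \<omega> X"

definition is_signature ::
    "real \<Rightarrow> real \<Rightarrow> (real \<Rightarrow> real \<Rightarrow> real) \<Rightarrow> (real \<Rightarrow> real \<Rightarrow> forest \<Rightarrow> real)
      \<Rightarrow> (real \<Rightarrow> real \<Rightarrow> forest \<Rightarrow> real) \<Rightarrow> bool" where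
  "is_signature \<rho> T \<omega> X \<X> \<longleftrightarrow>
     rough_on UNIV \<rho> T \<omega> \<X>
     \<and> (\<forall>s t f. 0 \<le> s \<and> s \<le> t \<and> t \<le> T \<and> int (weight f) \<le> \<lfloor>\<rho>\<rfloor> \<longrightarrow> \<X> s t f = X s t f)"

text \<open>Factorisation of the signature through \<open>arborification\<close>. Since the latter is a surjective
  algebra morphism, the linear functional \<open>Y\<close> is then automatically a character.\<close>

definition quasi_geometric :: "real \<Rightarrow> (real \<Rightarrow> real \<Rightarrow> forest \<Rightarrow> real) \<Rightarrow> bool" where
  "quasi_geometric T \<X> \<longleftrightarrow>
     (\<forall>s t. 0 \<le> s \<and> s \<le> t \<and> t \<le> T \<longrightarrow>
        (\<exists>Y :: letter list \<Rightarrow> real. \<forall>f. \<X> s t f = lin_ext Y (arborification f)))"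

end

theory Submission
  imports Defs
begin

text \<open>
  The idea. In the quasi-shuffle algebra let \<open>y = x\<^sup>m\<close>, so that \<open>y\<^sup>i\<close> is the letter
  \<open>x\<^sup>m\<^sup>i\<close>. The words \<open>y\<dots>y\<close> with \<open>n\<close> letters and the one-letter words \<open>y\<^sup>i\<close> satisfy the relations
  between the elementary symmetric functions \<open>e\<^sub>n\<close> and the power sums \<open>p\<^sub>i\<close>: the quasi-shuffle
  of \<open>k\<close> copies of \<open>y\<close> with \<open>y\<^sup>i\<close> either inserts \<open>y\<^sup>i\<close> or merges it with one of the copies, and
  in the alternating sum of these products the two kinds of terms telescope, which is Newton's
  identity \<open>n e\<^sub>n = \<Sum> (-1)\<^sup>i\<^sup>-\<^sup>1 e\<^sub>n\<^sub>-\<^sub>i p\<^sub>i\<close> (\<open>newton_identity\<close>). Solving this recursion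
  expresses \<open>e\<^sub>n\<close> through the cycle index of the symmetric group (\<open>newton_cycle_index\<close>), and
  a signature, being a character, may be applied to the result.

  What remains is to see that arborification sends the \<open>n\<close>-th growth power of
  the primitive part of \<open>m\<close> isolated vertices to the word with \<open>n\<close> letters \<open>y\<close>
  (\<open>arb_growth_power_primitive_part\<close>). Growing onto a primitive element behaves for the coproduct
  like appending a letter behaves for deconcatenation (\<open>cut_sum_growth_primitive\<close>), and
  the one-letter part of an arborified forest vanishes as soon as the forest has an edge. Reading
  off the last letter with the coproduct then shows that growing onto \<open>p\<close> is turned into
  concatenation with the one-letter part of \<open>p\<close> (\<open>lookup_arb_growth\<close>).

  Both the projection onto the primitive elements and arborification are given by descriptions that
  have to be shown to determine exactly one map. For the projection, the identity
  \<open>F = \<Sum> F' \<^bold>\<top> \<pi>(F'')\<close> over the cuts of a nonempty forest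
  serves as a recursive definition of \<open>\<pi>\<close>: coassociativity shows that its values are primitive
  (\<open>primitive_part_primitive\<close>), it has the prescribed values on growth words
  (\<open>is_word_projection_primitive_part\<close>), and the identity itself shows that growth words span
  (\<open>growth_words_span\<close>). Arborification is constructed by recursion
  over trees; for this the quasi-shuffle product has to be associative, commutative and compatible with
  deconcatenation (\<open>arborification_eq_arb\<close>).

  Multilinear identities are stated throughout after application of an arbitrary linear
  functional, given by its values \<open>\<Psi>\<close> on the basis: \<open>lin_ext \<Psi> x\<close> is treated like an integral of
  \<open>\<Psi>\<close> over \<open>x\<close>, so that iterated coproducts become iterated sums which may be
  interchanged, and no triple tensor products occur.
\<close>

section \<open>Linear extension\<close>

lemma lin_ext_superset:
  assumes "finite S" "Poly_Mapping.keys x \<subseteq> S"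
  shows "lin_ext \<phi> x = (\<Sum>k\<in>S. Poly_Mapping.lookup x k *\<^sub>R \<phi> k)"
  unfolding lin_ext_def using assms
  by (intro sum.mono_neutral_left) (auto simp: in_keys_iff)

lemma lookup_scaleR [simp]:
  "Poly_Mapping.lookup (c *\<^sub>R x :: 'k \<Rightarrow>\<^sub>0 real) k = c * Poly_Mapping.lookup x k"
proof -
  have "finite {k. c * Poly_Mapping.lookup x k \<noteq> 0}"
    by (rule finite_subset[OF _ finite_keys[of x]]) (auto simp: in_keys_iff)
  then show ?thesis by (simp add: scaleR_poly_mapping_def)
qed

lemma lin_ext_add: "lin_ext \<phi> (x + y) = lin_ext \<phi> x + lin_ext \<phi> y"
proof -
  let ?S = "Poly_Mapping.keys x \<union> Poly_Mapping.keys y"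
  have "Poly_Mapping.keys (x + y) \<subseteq> ?S" by (rule keys_add)
  then show ?thesis
    by (simp add: lin_ext_superset[of ?S] lookup_add scaleR_add_left sum.distrib)
qed

lemma lin_ext_scale: "lin_ext \<phi> (c *\<^sub>R x) = c *\<^sub>R lin_ext \<phi> x"
proof -
  have "Poly_Mapping.keys (c *\<^sub>R x) \<subseteq> Poly_Mapping.keys x"
    by (auto simp: in_keys_iff)
  then show ?thesis
    by (simp add: lin_ext_superset[of "Poly_Mapping.keys x"] scaleR_sum_right)
qed

lemma linear_lin_ext: "linear (lin_ext \<phi>)"
  by (rule linearI) (simp_all add: lin_ext_add lin_ext_scale)

lemma lin_ext_zero [simp]: "lin_ext \<phi> 0 = 0"
  by (simp add: lin_ext_def)

lemma lin_ext_diff: "lin_ext \<phi> (x - y) = lin_ext \<phi> x - lin_ext \<phi> y"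
  by (rule linear_diff[OF linear_lin_ext])

lemma lin_ext_sum: "lin_ext \<phi> (\<Sum>i\<in>I. f i) = (\<Sum>i\<in>I. lin_ext \<phi> (f i))"
  by (rule linear_sum[OF linear_lin_ext])

lemma lin_ext_basis [simp]: "lin_ext \<phi> (basis k) = \<phi> k"
  by (simp add: lin_ext_def)

lemma lin_ext_cong:
  "(\<And>k. k \<in> Poly_Mapping.keys x \<Longrightarrow> \<phi> k = \<psi> k) \<Longrightarrow> lin_ext \<phi> x = lin_ext \<psi> x"
  by (simp add: lin_ext_def)

lemma lin_ext_fun_zero [simp]: "lin_ext (\<lambda>k. 0) x = 0"
  by (simp add: lin_ext_def)

lemma lin_ext_fun_add: "lin_ext (\<lambda>k. \<phi> k + \<psi> k) x = lin_ext \<phi> x + lin_ext \<psi> x"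
  by (simp add: lin_ext_def scaleR_add_right sum.distrib)

lemma linear_lin_ext_fun:
  assumes "linear g"
  shows "g (lin_ext \<phi> x) = lin_ext (\<lambda>k. g (\<phi> k)) x"
  using assms by (simp add: lin_ext_def linear_sum linear_scale)

lemma lin_ext_fun_scale: "lin_ext (\<lambda>k. c *\<^sub>R \<phi> k) x = c *\<^sub>R lin_ext \<phi> x"
  by (rule linear_lin_ext_fun[symmetric]) (rule linear_scale_self)

lemma lin_ext_fun_mult_left: "lin_ext (\<lambda>k. c * \<phi> k :: real) x = c * lin_ext \<phi> x"
  using lin_ext_fun_scale[of c \<phi> x] by simp

lemma lin_ext_fun_mult_right: "lin_ext (\<lambda>k. \<phi> k * c :: real) x = lin_ext \<phi> x * c"
  using lin_ext_fun_mult_left[of c \<phi> x] by (simp add: mult.commute)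

lemma lin_ext_fun_sum: "lin_ext (\<lambda>k. \<Sum>i\<in>I. \<phi> i k) x = (\<Sum>i\<in>I. lin_ext (\<phi> i) x)"
  by (induction I rule: infinite_finite_induct) (simp_all add: lin_ext_fun_add)

lemma lin_ext_lin_ext: "lin_ext \<phi> (lin_ext \<psi> x) = lin_ext (\<lambda>k. lin_ext \<phi> (\<psi> k)) x"
  by (rule linear_lin_ext_fun[OF linear_lin_ext])

lemma lin_ext_swap:
  "lin_ext (\<lambda>k. lin_ext (\<lambda>l. \<phi> k l) y) x = lin_ext (\<lambda>l. lin_ext (\<lambda>k. \<phi> k l) x) y"
  unfolding lin_ext_def scaleR_sum_right
  by (subst sum.swap) (simp add: mult.commute)

lemma lookup_lin_ext:
  fixes \<phi> :: "'l \<Rightarrow> ('k \<Rightarrow>\<^sub>0 real)"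
  shows "Poly_Mapping.lookup (lin_ext \<phi> x) k = lin_ext (\<lambda>l. Poly_Mapping.lookup (\<phi> l) k) x"
  by (rule linear_lin_ext_fun) (auto intro!: linearI simp: lookup_add)

lemma lookup_as_lin_ext:
  "Poly_Mapping.lookup x k = lin_ext (\<lambda>l. if l = k then 1 else 0) x"
proof -
  have "lin_ext (\<lambda>l. if l = k then 1 else 0 :: real) x
      = (\<Sum>l\<in>Poly_Mapping.keys x. if l = k then Poly_Mapping.lookup x l else 0)"
    unfolding lin_ext_def by (intro sum.cong) auto
  then show ?thesis by (simp add: in_keys_iff)
qed

lemma lin_ext_basis_id [simp]: "lin_ext basis x = x"
  by (rule poly_mapping_eqI) (simp add: lookup_lin_ext lookup_as_lin_ext[of x] lookup_single when_def)

lemma lin_ext_tensor: "lin_ext \<phi> (tensor x y) = lin_ext (\<lambda>k. lin_ext (\<lambda>l. \<phi> (k, l)) y) x"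
  by (simp add: tensor_def bilin_ext_def lin_ext_lin_ext)

section \<open>Vertices and cuts\<close>

lemma forest_induct [case_names empty add]:
  assumes empty: "P {#}"
    and add: "\<And>F G. P F \<Longrightarrow> P G \<Longrightarrow> P (add_mset (Node G) F)"
  shows "P F"
proof -
  have from_trees: "P F" if "\<And>t. t \<in># F \<Longrightarrow> P (branches t)" for F
    using that
  proof (induction F)
    case (add t F)
    then show ?case using assms(2)[of F "branches t"] by simp
  qed (rule empty)
  have "P (branches t)" for t
    by (induction t) (auto intro: from_trees)
  then show ?thesis by (blast intro: from_trees)
qed

lemma vertices_empty [simp]: "vertices {#} = {}"
  by (auto simp: vertices_def neq_Nil_conv)

lemma vertices_iff:
  "x # p \<in> vertices F \<longleftrightarrow>
     snd x < count F (fst x) \<and> (p = [] \<or> p \<in> vertices (branches (fst x)))"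
  by (auto simp: vertices_def)

lemma Nil_notin_vertices [simp]: "[] \<notin> vertices F"
  by (simp add: vertices_def)

text \<open>A new copy of a tree receives the first unused index, so the addresses of the vertices of
  \<open>F\<close> do not change when a tree is added.\<close>

lemma vertices_add:
  "vertices (add_mset (Node G) F) =
     vertices F \<union> insert [(Node G, count F (Node G))]
       ((#) (Node G, count F (Node G)) ` vertices G)"
  (is "?L = ?R")
proof (rule set_eqI)
  fix p
  show "p \<in> ?L \<longleftrightarrow> p \<in> ?R"
  proof (cases p)
    case (Cons x q)
    then show ?thesis
      by (cases x) (auto simp: vertices_iff image_iff less_Suc_eq)
  qed (auto)
qed

lemma new_root_notin_vertices: "(t, count F t) # q \<notin> vertices F"
  by (simp add: vertices_iff)

lemma finite_vertices [simp]: "finite (vertices F)"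
  by (induction F rule: forest_induct) (simp_all add: vertices_add)

lemma weight_empty [simp]: "weight {#} = 0"
  by (simp add: weight_def)

lemma weight_add [simp]: "weight (add_mset (Node G) F) = Suc (weight F + weight G)"
proof -
  let ?x = "(Node G, count F (Node G))"
  have "card (insert [?x] ((#) ?x ` vertices G)) = Suc (card (vertices G))"
    by (subst card_insert_disjoint) (auto simp: card_image)
  moreover have "vertices F \<inter> insert [?x] ((#) ?x ` vertices G) = {}"
    by (auto simp: new_root_notin_vertices)
  ultimately show ?thesis
    unfolding weight_def vertices_add by (subst card_Un_disjoint) auto
qed

lemma weight_union [simp]: "weight (F + G) = weight F + weight G"
  by (induction F rule: forest_induct) simp_all

lemma weight_eq_0_iff [simp]: "weight F = 0 \<longleftrightarrow> F = {#}"
  by (induction F rule: forest_induct) simp_all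

lemma weight_pos_iff [simp]: "0 < weight F \<longleftrightarrow> F \<noteq> {#}"
  using weight_eq_0_iff[of F] by linarith

lemma restrict_forest_cong:
  "A \<inter> vertices F = B \<inter> vertices F \<Longrightarrow> restrict_forest F A = restrict_forest F B"
proof (induction F A arbitrary: B rule: restrict_forest.induct)
  case (1 F A)
  have mem: "p \<in> A \<longleftrightarrow> p \<in> B" if "p \<in> vertices F" for p
    using "1.prems" that by blast
  show ?case
    unfolding restrict_forest.simps[of F]
  proof (intro sum.cong refl)
    fix t i assume ti: "t \<in> set_mset F" "i \<in> {..<count F t}"
    have "restrict_forest (branches t) {q. (t, i) # q \<in> A}
        = restrict_forest (branches t) {q. (t, i) # q \<in> B}"
      using ti by (intro "1.IH") (auto simp: mem vertices_iff)
    moreover have "[(t, i)] \<in> A \<longleftrightarrow> [(t, i)] \<in> B"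
      using ti by (intro mem) (auto simp: vertices_iff)
    ultimately show "(let G = restrict_forest (branches t) {q. (t, i) # q \<in> A}
        in if [(t, i)] \<in> A then {#Node G#} else G) =
       (let G = restrict_forest (branches t) {q. (t, i) # q \<in> B}
        in if [(t, i)] \<in> B then {#Node G#} else G)"
      by simp
  qed
qed

lemma restrict_forest_empty_forest [simp]: "restrict_forest {#} A = {#}"
  by (subst restrict_forest.simps) simp

lemma restrict_forest_add:
  fixes G :: forest
  defines "t \<equiv> Node G"
  shows "restrict_forest (add_mset t F) A = restrict_forest F A +
     (let H = restrict_forest G {q. (t, count F t) # q \<in> A}
      in if [(t, count F t)] \<in> A then {#Node H#} else H)"
proof -
  define c where "c t i = (let H = restrict_forest (branches t) {q. (t, i) # q \<in> A}
        in if [(t, i)] \<in> A then {#Node H#} else H)" for t i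
  let ?S = "insert t (set_mset F)"
  have old: "restrict_forest F A = (\<Sum>s\<in>?S. \<Sum>i<count F s. c s i)"
    unfolding restrict_forest.simps[of F] c_def
    by (intro sum.mono_neutral_left) (auto simp: not_in_iff)
  have "restrict_forest (add_mset t F) A = (\<Sum>s\<in>?S. \<Sum>i<count (add_mset t F) s. c s i)"
    unfolding restrict_forest.simps[of "add_mset t F"] c_def set_mset_add_mset_insert ..
  also have "\<dots> = (\<Sum>s\<in>?S. (\<Sum>i<count F s. c s i) + (if s = t then c t (count F t) else {#}))"
    by (intro sum.cong) auto
  also have "\<dots> = (\<Sum>s\<in>?S. \<Sum>i<count F s. c s i) + c t (count F t)"
    unfolding sum.distrib by (subst sum.delta) simp_all
  also have "\<dots> = restrict_forest F A + c t (count F t)"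
    unfolding old ..
  finally show ?thesis
    unfolding c_def t_def rtree.sel .
qed

lemma restrict_forest_none [simp]: "restrict_forest F {} = {#}"
  by (induction F rule: forest_induct) (simp_all add: restrict_forest_add)

lemma restrict_forest_all: "vertices F \<subseteq> A \<Longrightarrow> restrict_forest F A = F"
proof (induction F arbitrary: A rule: forest_induct)
  case (add F G)
  have "vertices F \<subseteq> A" "vertices G \<subseteq> {q. (Node G, count F (Node G)) # q \<in> A}"
    and root: "[(Node G, count F (Node G))] \<in> A"
    using add.prems by (auto simp: vertices_add)
  from add.IH(1)[OF this(1)] add.IH(2)[OF this(2)] show ?case
    unfolding restrict_forest_add by (simp add: root)
qed simp

text \<open>A closed set that contains the root of the new tree contains the whole tree; otherwise its trace
  on the tree is a closed set of the branches. No condition links the old forest with the new tree.\<close>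

lemma descendant_closed_add:
  fixes F G
  defines "x \<equiv> (Node G, count F (Node G))"
  shows "{A. descendant_closed (add_mset (Node G) F) A} =
     (\<lambda>A. A \<union> insert [x] ((#) x ` vertices G)) ` {A. descendant_closed F A} \<union>
     (\<lambda>(A, B). A \<union> (#) x ` B) ` ({A. descendant_closed F A} \<times> {B. descendant_closed G B})"
  (is "?L = ?M \<union> ?N")
proof
  have V: "vertices (add_mset (Node G) F) = vertices F \<union> insert [x] ((#) x ` vertices G)"
    unfolding x_def by (rule vertices_add)
  have x: "x # q \<notin> vertices F" for q
    unfolding x_def by (rule new_root_notin_vertices)
  show "?L \<subseteq> ?M \<union> ?N"
  proof
    fix A assume "A \<in> ?L"
    then have A: "descendant_closed (add_mset (Node G) F) A" by simp
    then have sub: "A \<subseteq> vertices F \<union> insert [x] ((#) x ` vertices G)"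
      and cl: "\<And>p q. p \<in> A \<Longrightarrow> p @ q \<in> vertices F \<union> insert [x] ((#) x ` vertices G) \<Longrightarrow> p @ q \<in> A"
      unfolding descendant_closed_def V by blast+
    have A1: "descendant_closed F (A \<inter> vertices F)"
      using cl unfolding descendant_closed_def by blast
    have B: "descendant_closed G {q \<in> vertices G. x # q \<in> A}"
      unfolding descendant_closed_def
    proof (intro conjI ballI allI impI)
      fix p q assume "p \<in> {q \<in> vertices G. x # q \<in> A}" "p @ q \<in> vertices G"
      then show "p @ q \<in> {q \<in> vertices G. x # q \<in> A}"
        using cl[of "x # p" q] by simp
    qed simp
    show "A \<in> ?M \<union> ?N"
    proof (cases "[x] \<in> A")
      case True
      have "p \<in> A" if "p \<in> insert [x] ((#) x ` vertices G)" for p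
        using that cl[OF True, of "tl p"] by auto
      then have "A = A \<inter> vertices F \<union> insert [x] ((#) x ` vertices G)"
        using sub by blast
      then have "A \<in> ?M" by (rule image_eqI) (simp add: A1)
      then show ?thesis by (rule UnI1)
    next
      case False
      then have "A = (case (A \<inter> vertices F, {q \<in> vertices G. x # q \<in> A}) of (A, B) \<Rightarrow> A \<union> (#) x ` B)"
        unfolding prod.case using sub by blast
      then have "A \<in> ?N" by (rule image_eqI) (simp add: A1 B)
      then show ?thesis by (rule UnI2)
    qed
  qed
  have old: "p @ q \<in> A"
    if "descendant_closed F A" "p \<in> A" "p @ q \<in> vertices F \<union> insert [x] ((#) x ` vertices G)"
    for p q A
  proof -
    have "p \<in> vertices F" using that by (auto simp: descendant_closed_def)
    then obtain y r where "p = y # r" "y \<noteq> x"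
      using x by (cases p) (auto)
    then have "p @ q \<in> vertices F" using that by auto
    then show ?thesis using that by (auto simp: descendant_closed_def)
  qed
  have new: "q = [] \<or> q \<in> vertices G" if "x # q \<in> vertices F \<union> insert [x] ((#) x ` vertices G)" for q
    using that x by auto
  show "?M \<union> ?N \<subseteq> ?L"
  proof
    fix A assume "A \<in> ?M \<union> ?N"
    then show "A \<in> ?L"
    proof
      assume "A \<in> ?M"
      then obtain A1 where A1: "descendant_closed F A1"
        and A: "A = A1 \<union> insert [x] ((#) x ` vertices G)" by blast
      have "p @ q \<in> A" if p: "p \<in> A" and pq: "p @ q \<in> vertices F \<union> insert [x] ((#) x ` vertices G)" for p q
      proof (cases "p \<in> A1")
        case True
        then show ?thesis using old[OF A1 _ pq] A by blast
      next
        case False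
        then obtain r where "p = x # r" using p unfolding A by auto
        then show ?thesis using pq x A by auto
      qed
      moreover have "A \<subseteq> vertices F \<union> insert [x] ((#) x ` vertices G)"
        using A1 unfolding descendant_closed_def A by auto
      ultimately show ?thesis
        unfolding descendant_closed_def V mem_Collect_eq by blast
    next
      assume "A \<in> ?N"
      then obtain A1 B where A1: "descendant_closed F A1" and B: "descendant_closed G B"
        and A: "A = A1 \<union> (#) x ` B" by blast
      have "p @ q \<in> A" if p: "p \<in> A" and pq: "p @ q \<in> vertices F \<union> insert [x] ((#) x ` vertices G)" for p q
      proof (cases "p \<in> A1")
        case True
        then show ?thesis using old[OF A1 _ pq] A by blast
      next
        case False
        then obtain r where r: "p = x # r" "r \<in> B" using p unfolding A by auto
        then have "r @ q \<in> vertices G"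
          using pq x B by (auto simp: descendant_closed_def)
        then show ?thesis using B r A by (auto simp: descendant_closed_def)
      qed
      moreover have "A \<subseteq> vertices F \<union> insert [x] ((#) x ` vertices G)"
        using A1 B unfolding descendant_closed_def A by auto
      ultimately show ?thesis
        unfolding descendant_closed_def V mem_Collect_eq by blast
    qed
  qed
qed

lemma finite_descendant_closed [simp]: "finite {A. descendant_closed F A}"
  by (rule finite_subset[of _ "Pow (vertices F)"]) (auto simp: descendant_closed_def)

text \<open>The coproduct, paired with the functional that is \<open>\<Psi> a b\<close> on \<open>a \<otimes> b\<close>. The first argument is the
  part that is cut off, which lies above the second.\<close>

definition cut_sum :: "(forest \<Rightarrow> forest \<Rightarrow> 'v::real_vector) \<Rightarrow> forest \<Rightarrow> 'v" where
  "cut_sum \<Psi> F = (\<Sum>A | descendant_closed F A.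
     \<Psi> (restrict_forest F A) (restrict_forest F (vertices F - A)))"

lemma cut_sum_empty [simp]: "cut_sum \<Psi> {#} = \<Psi> {#} {#}"
proof -
  have "{A. descendant_closed {#} A} = {{}}" by (auto simp: descendant_closed_def)
  then show ?thesis by (simp add: cut_sum_def)
qed

text \<open>With \<open>B\<close> for grafting onto a new root, this is the cocycle equation
  \<open>\<Delta>(B G) = B G \<otimes> 1 + (id \<otimes> B) \<Delta> G\<close> together with multiplicativity of \<open>\<Delta>\<close> for the product with a
  tree. It replaces the addresses in all further arguments about cuts.\<close>

lemma cut_sum_add:
  "cut_sum \<Psi> (add_mset (Node G) F) =
     cut_sum (\<lambda>a b. \<Psi> (add_mset (Node G) a) b) F +
     cut_sum (\<lambda>a b. cut_sum (\<lambda>c d. \<Psi> (a + c) (add_mset (Node d) b)) G) F"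
proof -
  define x where "x = (Node G, count F (Node G))"
  let ?H = "add_mset (Node G) F"
  let ?CF = "{A. descendant_closed F A}" and ?CG = "{A. descendant_closed G A}"
  let ?whole = "\<lambda>A. A \<union> insert [x] ((#) x ` vertices G)"
  let ?part = "\<lambda>(A, B). A \<union> (#) x ` B"
  define T where "T A = \<Psi> (restrict_forest ?H A) (restrict_forest ?H (vertices ?H - A))" for A
  have V: "vertices ?H = vertices F \<union> insert [x] ((#) x ` vertices G)"
    unfolding x_def by (rule vertices_add)
  have x: "x # q \<notin> vertices F" for q
    unfolding x_def by (rule new_root_notin_vertices)
  have sub: "A \<subseteq> vertices F" if "A \<in> ?CF" for A using that by (simp add: descendant_closed_def)
  have subG: "B \<subseteq> vertices G" if "B \<in> ?CG" for B using that by (simp add: descendant_closed_def)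
  have x': "x # q \<notin> A" if "A \<in> ?CF" for q A using sub[OF that] x by blast
  have split: "restrict_forest ?H A = restrict_forest F A +
     (let H = restrict_forest G {q. x # q \<in> A} in if [x] \<in> A then {#Node H#} else H)" for A
    unfolding x_def by (rule restrict_forest_add)
  have disj: "?whole ` ?CF \<inter> ?part ` (?CF \<times> ?CG) = {}"
  proof -
    have "[x] \<notin> ?part P" if "P \<in> ?CF \<times> ?CG" for P
      using that x' subG Nil_notin_vertices[of G] by (cases P) blast
    moreover have "[x] \<in> ?whole A" for A by simp
    ultimately show ?thesis by (metis (no_types, lifting) disjoint_iff imageE)
  qed
  have inj1: "inj_on ?whole ?CF"
  proof (rule inj_onI)
    fix A A' assume "A \<in> ?CF" "A' \<in> ?CF" and eq: "?whole A = ?whole A'"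
    then have "A = ?whole A \<inter> vertices F" "A' = ?whole A' \<inter> vertices F"
      using sub x by blast+
    then show "A = A'" using eq by simp
  qed
  have inj2: "inj_on ?part (?CF \<times> ?CG)"
  proof (rule inj_onI)
    fix P P' assume P: "P \<in> ?CF \<times> ?CG" "P' \<in> ?CF \<times> ?CG" and eq: "?part P = ?part P'"
    have "Q = (?part Q \<inter> vertices F, {q. x # q \<in> ?part Q})" if "Q \<in> ?CF \<times> ?CG" for Q
      using that sub x x' by (cases Q) auto
    then show "P = P'" using P eq by metis
  qed
  have whole: "T (?whole A) = \<Psi> (add_mset (Node G) (restrict_forest F A)) (restrict_forest F (vertices F - A))"
    if A: "A \<in> ?CF" for A
  proof -
    have a: "restrict_forest F (?whole A) = restrict_forest F A"
      by (rule restrict_forest_cong) (use x in blast)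
    have b: "restrict_forest F (vertices ?H - ?whole A) = restrict_forest F (vertices F - A)"
      by (rule restrict_forest_cong) (use x in \<open>auto simp: V\<close>)
    have c: "restrict_forest G {q. x # q \<in> ?whole A} = G"
      by (rule restrict_forest_all) auto
    have d: "{q. x # q \<in> vertices ?H - ?whole A} = {}"
      using x by (auto simp: V)
    show ?thesis
      unfolding T_def split a b c d by (simp add: V x)
  qed
  have part: "T (?part (A, B)) = \<Psi> (restrict_forest F A + restrict_forest G B)
      (add_mset (Node (restrict_forest G (vertices G - B))) (restrict_forest F (vertices F - A)))"
    if A: "A \<in> ?CF" and B: "B \<in> ?CG" for A B
  proof -
    have a: "restrict_forest F (A \<union> (#) x ` B) = restrict_forest F A"
      by (rule restrict_forest_cong) (use x in blast)
    have b: "restrict_forest F (vertices ?H - (A \<union> (#) x ` B)) = restrict_forest F (vertices F - A)"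
      by (rule restrict_forest_cong) (use x in \<open>auto simp: V\<close>)
    have c: "{q. x # q \<in> A \<union> (#) x ` B} = B"
      using x'[OF A] by auto
    have d: "restrict_forest G {q. x # q \<in> vertices ?H - (A \<union> (#) x ` B)}
        = restrict_forest G (vertices G - B)"
      by (rule restrict_forest_cong) (use x x'[OF A] in \<open>auto simp: V\<close>)
    have e: "[x] \<notin> A \<union> (#) x ` B" using x'[OF A] subG[OF B] by auto
    show ?thesis
      unfolding T_def prod.case split a b c d using e by (simp add: V)
  qed
  have "cut_sum \<Psi> ?H = sum T (?whole ` ?CF \<union> ?part ` (?CF \<times> ?CG))"
    unfolding cut_sum_def T_def descendant_closed_add x_def by simp
  also have "\<dots> = sum T (?whole ` ?CF) + sum T (?part ` (?CF \<times> ?CG))"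
    by (rule sum.union_disjoint) (use disj in simp_all)
  also have "sum T (?whole ` ?CF) = (\<Sum>A\<in>?CF. T (?whole A))"
    using inj1 by (simp add: sum.reindex)
  also have "\<dots> = cut_sum (\<lambda>a b. \<Psi> (add_mset (Node G) a) b) F"
    unfolding cut_sum_def by (rule sum.cong[OF refl]) (rule whole)
  also have "sum T (?part ` (?CF \<times> ?CG)) = (\<Sum>P\<in>?CF \<times> ?CG. T (?part P))"
    using inj2 by (simp add: sum.reindex)
  also have "\<dots> = (\<Sum>A\<in>?CF. \<Sum>B\<in>?CG. T (?part (A, B)))"
    unfolding sum.cartesian_product by (rule sum.cong) auto
  also have "\<dots> = cut_sum (\<lambda>a b. cut_sum (\<lambda>c d. \<Psi> (a + c) (add_mset (Node d) b)) G) F"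
    unfolding cut_sum_def by (intro sum.cong refl) (simp only: part)
  finally show ?thesis .
qed

section \<open>Sums over the cuts of a forest\<close>

lemma lin_ext_ck_coproduct: "lin_ext \<phi> (ck_coproduct F) = cut_sum (\<lambda>a b. \<phi> (a, b)) F"
  by (simp add: ck_coproduct_def cut_sum_def lin_ext_sum)

lemma cut_sum_fun_add:
  "cut_sum (\<lambda>a b. \<Phi> a b + \<Psi> a b) F = cut_sum \<Phi> F + cut_sum \<Psi> F"
  by (simp add: cut_sum_def sum.distrib)

lemma cut_sum_fun_diff:
  "cut_sum (\<lambda>a b. \<Phi> a b - \<Psi> a b) F = cut_sum \<Phi> F - cut_sum \<Psi> F"
  by (simp add: cut_sum_def sum_subtractf)

lemma cut_sum_fun_zero [simp]: "cut_sum (\<lambda>a b. 0) F = 0"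
  by (simp add: cut_sum_def)

lemma linear_cut_sum:
  assumes "linear g"
  shows "g (cut_sum \<Psi> F) = cut_sum (\<lambda>a b. g (\<Psi> a b)) F"
  using assms by (simp add: cut_sum_def linear_sum)

lemma cut_sum_fun_scale: "cut_sum (\<lambda>a b. c *\<^sub>R \<Psi> a b) F = c *\<^sub>R cut_sum \<Psi> F"
  by (rule linear_cut_sum[symmetric]) (rule linear_scale_self)

lemma lin_ext_cut_sum: "lin_ext \<phi> (cut_sum \<Psi> F) = cut_sum (\<lambda>a b. lin_ext \<phi> (\<Psi> a b)) F"
  by (rule linear_cut_sum[OF linear_lin_ext])

lemma cut_sum_lin_ext_swap:
  "lin_ext (\<lambda>k. cut_sum (\<lambda>a b. \<Psi> k a b) F) x = cut_sum (\<lambda>a b. lin_ext (\<lambda>k. \<Psi> k a b) x) F"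
  by (simp add: cut_sum_def lin_ext_fun_sum)

lemma cut_sum_fun_sum:
  "cut_sum (\<lambda>a b. \<Sum>i\<in>I. \<Psi> i a b) F = (\<Sum>i\<in>I. cut_sum (\<Psi> i) F)"
  unfolding cut_sum_def by (rule sum.swap)

lemma cut_sum_swap:
  "cut_sum (\<lambda>a b. cut_sum (\<lambda>c d. \<Psi> a b c d) G) F = cut_sum (\<lambda>c d. cut_sum (\<lambda>a b. \<Psi> a b c d) F) G"
  unfolding cut_sum_def by (rule sum.swap)

lemma cut_sum_tree:
  "cut_sum \<Psi> {#Node G#} = \<Psi> {#Node G#} {#} + cut_sum (\<lambda>a b. \<Psi> a {#Node b#}) G"
  using cut_sum_add[of \<Psi> G "{#}"] by simp

lemma cut_sum_union:
  "cut_sum \<Psi> (F + G) = cut_sum (\<lambda>a b. cut_sum (\<lambda>c d. \<Psi> (a + c) (b + d)) G) F"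
proof (induction F arbitrary: \<Psi> rule: forest_induct)
  case (add F T)
  show ?case
    unfolding union_mset_add_mset_left cut_sum_add add.IH
    by (simp add: cut_sum_fun_add cut_sum_swap[where F = T and G = G] ac_simps)
qed simp

text \<open>The coproduct is graded: a cut distributes the vertices over its two parts.\<close>

lemma cut_sum_cong:
  assumes "\<And>a b. weight a + weight b = weight F \<Longrightarrow> \<Phi> a b = \<Psi> a b"
  shows "cut_sum \<Phi> F = cut_sum \<Psi> F"
  using assms
proof (induction F arbitrary: \<Phi> \<Psi> rule: forest_induct)
  case (add F G)
  show ?case
    unfolding cut_sum_add
  proof (rule arg_cong2[of _ _ _ _ "(+)"])
    show "cut_sum (\<lambda>a b. \<Phi> (add_mset (Node G) a) b) F = cut_sum (\<lambda>a b. \<Psi> (add_mset (Node G) a) b) F"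
      by (rule add.IH(1)) (simp add: add.prems)
    show "cut_sum (\<lambda>a b. cut_sum (\<lambda>c d. \<Phi> (a + c) (add_mset (Node d) b)) G) F =
        cut_sum (\<lambda>a b. cut_sum (\<lambda>c d. \<Psi> (a + c) (add_mset (Node d) b)) G) F"
      by (intro add.IH) (simp add: add.prems)
  qed
qed simp

text \<open>The only cut with nothing cut off is the trivial one. Together with its mirror image this isolates
  the two extreme terms of a coproduct.\<close>

lemma cut_sum_counit_left: "cut_sum (\<lambda>a b. if a = {#} then \<Psi> b else 0) F = \<Psi> F"
proof (induction F arbitrary: \<Psi> rule: forest_induct)
  case (add F G)
  have "cut_sum (\<lambda>c d. if a + c = {#} then \<Psi> (add_mset (Node d) b) else 0) G
      = (if a = {#} then \<Psi> (add_mset (Node G) b) else 0)" for a b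
    using add.IH(2)[of "\<lambda>d. \<Psi> (add_mset (Node d) b)"] by simp
  note tree = this
  have "cut_sum (\<lambda>a b. if a = {#} then \<Psi> b else 0) (add_mset (Node G) F) =
      cut_sum (\<lambda>a b. cut_sum (\<lambda>c d. if a + c = {#} then \<Psi> (add_mset (Node d) b) else 0) G) F"
    unfolding cut_sum_add by simp
  also have "\<dots> = \<Psi> (add_mset (Node G) F)"
    unfolding tree by (rule add.IH(1))
  finally show ?case .
qed simp

lemma cut_sum_counit_right: "cut_sum (\<lambda>a b. if b = {#} then \<Psi> a else 0) F = \<Psi> F"
  by (induction F arbitrary: \<Psi> rule: forest_induct) (simp_all add: cut_sum_add)

text \<open>For a single tree coassociativity follows from the cocycle equation, and it is inherited by products
  because the coproduct is multiplicative.\<close>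

lemma cut_sum_coassoc:
  "cut_sum (\<lambda>e c. cut_sum (\<lambda>a b. \<Phi> a b c) e) F = cut_sum (\<lambda>a e. cut_sum (\<lambda>b c. \<Phi> a b c) e) F"
proof (induction F arbitrary: \<Phi> rule: forest_induct)
  case (add F G)
  have tree: "cut_sum (\<lambda>e c. cut_sum (\<lambda>a b. \<Phi> a b c) e) {#Node G#}
     = cut_sum (\<lambda>a e. cut_sum (\<lambda>b c. \<Phi> a b c) e) {#Node G#}" for \<Phi> :: "forest \<Rightarrow> forest \<Rightarrow> forest \<Rightarrow> 'a"
    by (simp add: cut_sum_tree cut_sum_fun_add add.IH(2))
  have "cut_sum (\<lambda>e c. cut_sum (\<lambda>a b. \<Phi> a b c) e) (F + {#Node G#}) =
     cut_sum (\<lambda>e c. cut_sum (\<lambda>e' c'. cut_sum (\<lambda>a b. cut_sum (\<lambda>a' b'.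
       \<Phi> (a + a') (b + b') (c + c')) e') e) {#Node G#}) F"
    by (simp only: cut_sum_union)
  also have "\<dots> = cut_sum (\<lambda>e c. cut_sum (\<lambda>a b. cut_sum (\<lambda>e' c'. cut_sum (\<lambda>a' b'.
       \<Phi> (a + a') (b + b') (c + c')) e') {#Node G#}) e) F"
    by (subst (2) cut_sum_swap) (rule refl)
  also have "\<dots> = cut_sum (\<lambda>e c. cut_sum (\<lambda>a b. cut_sum (\<lambda>a' e'. cut_sum (\<lambda>b' c'.
       \<Phi> (a + a') (b + b') (c + c')) e') {#Node G#}) e) F"
    by (subst tree) (rule refl)
  also have "\<dots> = cut_sum (\<lambda>a e. cut_sum (\<lambda>b c. cut_sum (\<lambda>a' e'. cut_sum (\<lambda>b' c'.
       \<Phi> (a + a') (b + b') (c + c')) e') {#Node G#}) e) F"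
    by (rule add.IH(1))
  also have "\<dots> = cut_sum (\<lambda>a e. cut_sum (\<lambda>a' e'. cut_sum (\<lambda>b c. cut_sum (\<lambda>b' c'.
       \<Phi> (a + a') (b + b') (c + c')) e') e) {#Node G#}) F"
    by (subst (2) cut_sum_swap) (rule refl)
  also have "\<dots> = cut_sum (\<lambda>a e. cut_sum (\<lambda>b c. \<Phi> a b c) e) (F + {#Node G#})"
    by (simp only: cut_sum_union)
  finally show ?case by simp
qed simp

section \<open>Grafting and cuts\<close>

definition graft_sum :: "(forest \<Rightarrow> 'v::real_vector) \<Rightarrow> forest \<Rightarrow> forest \<Rightarrow> 'v" where
  "graft_sum \<Psi> f g = (\<Sum>v\<in>vertices g. \<Psi> (graft f v g))"

lemma graft_sum_empty [simp]: "graft_sum \<Psi> f {#} = 0"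
  by (simp add: graft_sum_def)

text \<open>Grafting is a derivation of the product of forests, and a vertex of \<open>[G]\<close> is its root or a vertex
  of \<open>G\<close>.\<close>

lemma graft_sum_add:
  "graft_sum \<Psi> f (add_mset (Node G) F) =
     graft_sum (\<lambda>h. \<Psi> (add_mset (Node G) h)) f F + \<Psi> (add_mset (Node (G + f)) F) +
     graft_sum (\<lambda>h. \<Psi> (add_mset (Node h) F)) f G"
proof -
  let ?x = "(Node G, count F (Node G))"
  have old: "graft f v (add_mset (Node G) F) = add_mset (Node G) (graft f v F)"
    if v: "v \<in> vertices F" for v
  proof (cases v)
    case (Cons y p)
    then have "0 < count F (fst y)"
      using v unfolding Cons vertices_iff by linarith
    then have "fst y \<in># F" by (simp only: count_greater_zero_iff)
    then show ?thesis unfolding Cons by simp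
  qed (use v in simp)
  have disj: "vertices F \<inter> insert [?x] ((#) ?x ` vertices G) = {}"
    by (auto simp: new_root_notin_vertices)
  have "graft_sum \<Psi> f (add_mset (Node G) F) =
    (\<Sum>v\<in>vertices F. \<Psi> (graft f v (add_mset (Node G) F))) +
    (\<Sum>v\<in>insert [?x] ((#) ?x ` vertices G). \<Psi> (graft f v (add_mset (Node G) F)))"
    unfolding graft_sum_def vertices_add using disj by (intro sum.union_disjoint) auto
  also have "(\<Sum>v\<in>insert [?x] ((#) ?x ` vertices G). \<Psi> (graft f v (add_mset (Node G) F))) =
    \<Psi> (add_mset (Node (G + f)) F) + (\<Sum>p\<in>vertices G. \<Psi> (add_mset (Node (graft f p G)) F))"
    by (subst sum.insert) (auto simp: sum.reindex)
  finally show ?thesis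
    by (simp add: graft_sum_def old add.assoc)
qed

lemma graft_sum_fun_add:
  "graft_sum (\<lambda>h. \<Phi> h + \<Psi> h) f g = graft_sum \<Phi> f g + graft_sum \<Psi> f g"
  by (simp add: graft_sum_def sum.distrib)

lemma cut_sum_graft_sum_swap:
  "graft_sum (\<lambda>h. cut_sum (\<lambda>a b. \<Psi> h a b) F) f g = cut_sum (\<lambda>a b. graft_sum (\<lambda>h. \<Psi> h a b) f g) F"
  by (simp add: graft_sum_def cut_sum_fun_sum)

lemma graft_sum_empty_left: "graft_sum \<Psi> {#} g = real (weight g) *\<^sub>R \<Psi> g"
proof (induction g arbitrary: \<Psi> rule: forest_induct)
  case (add F G)
  then show ?case by (simp add: graft_sum_add algebra_simps)
qed simp

lemma graft_sum_union:
  "graft_sum \<Psi> f (F + G) = graft_sum (\<lambda>h. \<Psi> (h + G)) f F + graft_sum (\<lambda>h. \<Psi> (F + h)) f G"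
proof (induction F arbitrary: \<Psi> rule: forest_induct)
  case (add F T)
  show ?case
    by (simp add: graft_sum_add add.IH)
qed simp

text \<open>A closed set of the grafted forest meets \<open>g\<close> in a closed set. If this contains the vertex of
  grafting, then all of \<open>f\<close> is cut off with it; if not, then \<open>f\<close> is cut
  independently, and what remains of \<open>f\<close> is still grafted onto the same vertex.\<close>

lemma cut_sum_graft_sum:
  "graft_sum (cut_sum \<Psi>) f g =
     cut_sum (\<lambda>b c. graft_sum (\<lambda>h. \<Psi> h c) f b +
       cut_sum (\<lambda>a a'. graft_sum (\<lambda>h. \<Psi> (a + b) h) a' c) f) g"
proof (induction g arbitrary: \<Psi> rule: forest_induct)
  case (add F G)
  show ?case
    unfolding cut_sum_add graft_sum_add
    by (simp add: cut_sum_fun_add cut_sum_graft_sum_swap graft_sum_fun_add add.IH)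
      (simp add: cut_sum_union graft_sum_union cut_sum_fun_add cut_sum_swap[where F = f and G = G] ac_simps)
qed simp

text \<open>The empty forest and the unit of \<open>forest \<Rightarrow>\<^sub>0 real\<close> as a monoid algebra are related by
  \<open>basis {#} = 1\<close>, because \<open>{#}\<close> is the zero of the additive monoid of multisets. This
  must not be used as a rewrite rule, since the rules below speak of basis elements.\<close>

declare Poly_Mapping.single_one [simp del]

section \<open>Growing onto a primitive element\<close>

lemma primitive_cut_sum:
  assumes "p \<in> primitives"
  shows "lin_ext (cut_sum \<Psi>) p = lin_ext (\<lambda>F. \<Psi> F {#} + \<Psi> {#} F) p"
proof -
  have "lin_ext (\<lambda>(a, b). \<Psi> a b) (lin_ext ck_coproduct p) =
      lin_ext (\<lambda>(a, b). \<Psi> a b) (tensor p (basis {#}) + tensor (basis {#}) p)"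
    using assms by (simp add: primitives_def)
  then show ?thesis
    unfolding lin_ext_lin_ext lin_ext_ck_coproduct lin_ext_add lin_ext_tensor lin_ext_fun_add
      prod.case lin_ext_basis .
qed

lemma primitiveI:
  assumes "lin_ext (cut_sum (\<lambda>a b. basis (a, b))) p =
    lin_ext (\<lambda>F. basis (F, {#}) + basis ({#}, F)) p"
  shows "p \<in> primitives"
proof -
  have "ck_coproduct = cut_sum (\<lambda>a b. basis (a, b))"
    by (simp add: fun_eq_iff ck_coproduct_def cut_sum_def)
  with assms show ?thesis
    by (simp add: primitives_def tensor_def bilin_ext_def lin_ext_fun_add)
qed

text \<open>Apply the counit to both factors of the coproduct: the value of the counit at \<open>p\<close> equals twice
  itself.\<close>

lemma primitive_lookup_empty:
  assumes "p \<in> primitives"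
  shows "Poly_Mapping.lookup p {#} = 0"
proof -
  define \<delta> :: "forest \<Rightarrow> real" where "\<delta> F = (if F = {#} then 1 else 0)" for F
  have "cut_sum (\<lambda>a b. \<delta> a * \<delta> b) F = \<delta> F" for F
  proof -
    have "\<delta> a * \<delta> b = (if a = {#} then \<delta> b else 0)" for a b by (simp add: \<delta>_def)
    then show ?thesis by (simp only: cut_sum_counit_left)
  qed
  then have "cut_sum (\<lambda>a b. \<delta> a * \<delta> b) = \<delta>" by (rule ext)
  then have "lin_ext \<delta> p = lin_ext (cut_sum (\<lambda>a b. \<delta> a * \<delta> b)) p" by simp
  also have "\<dots> = lin_ext (\<lambda>F. \<delta> F + \<delta> F) p"
    unfolding primitive_cut_sum[OF assms] by (rule lin_ext_cong) (simp add: \<delta>_def)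
  finally have "lin_ext \<delta> p = 0"
    unfolding lin_ext_fun_add by (metis add_cancel_right_right)
  then show ?thesis
    by (simp add: lookup_as_lin_ext \<delta>_def[abs_def])
qed

lemma lin_ext_primitive_cong:
  assumes "p \<in> primitives" and "\<And>F. F \<noteq> {#} \<Longrightarrow> \<phi> F = \<psi> F"
  shows "lin_ext \<phi> p = lin_ext \<psi> p"
proof (rule lin_ext_cong)
  fix F assume "F \<in> Poly_Mapping.keys p"
  then have "F \<noteq> {#}"
    using primitive_lookup_empty[OF assms(1)] by (auto simp: in_keys_iff)
  then show "\<phi> F = \<psi> F" by (rule assms(2))
qed

lemma lin_ext_growth_forest:
  assumes "g \<noteq> {#}"
  shows "lin_ext \<phi> (growth_forest f g) = (1 / real (weight g)) *\<^sub>R graft_sum \<phi> f g"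
proof (cases "f = {#}")
  case True
  then show ?thesis using assms by (simp add: growth_forest_def graft_sum_empty_left)
next
  case False
  then show ?thesis
    using assms by (simp add: growth_forest_def lin_ext_scale lin_ext_sum graft_sum_def)
qed

lemma graft_nonempty: "v \<in> vertices g \<Longrightarrow> graft f v g \<noteq> {#}"
  by (cases v) simp_all

lemma lin_ext_natural_growth:
  "lin_ext \<phi> (x \<^bold>\<top> y) = lin_ext (\<lambda>f. lin_ext (\<lambda>g. lin_ext \<phi> (growth_forest f g)) y) x"
  by (simp add: natural_growth_def bilin_ext_def lin_ext_lin_ext)

lemma natural_growth_empty_left [simp]: "basis {#} \<^bold>\<top> y = y"
proof -
  have "growth_forest {#} = basis" by (auto simp: growth_forest_def)
  then show ?thesis by (simp add: natural_growth_def bilin_ext_def)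
qed

lemma natural_growth_as_lin_ext: "x \<^bold>\<top> y = lin_ext (\<lambda>f. basis f \<^bold>\<top> y) x"
  by (simp add: natural_growth_def bilin_ext_def)

lemma linear_natural_growth_left: "linear (\<lambda>x. x \<^bold>\<top> y)"
  unfolding natural_growth_def bilin_ext_def by (rule linear_lin_ext)

lemma linear_natural_growth_right: "linear (\<lambda>y. x \<^bold>\<top> y)"
  unfolding natural_growth_def bilin_ext_def
  by (rule linearI) (simp_all add: lin_ext_add lin_ext_scale lin_ext_fun_add lin_ext_fun_scale)

lemma natural_growth_zero_right [simp]: "x \<^bold>\<top> 0 = 0"
  by (rule linear_0[OF linear_natural_growth_right])

lemma lookup_natural_growth_empty:
  assumes "p \<in> primitives"
  shows "Poly_Mapping.lookup (x \<^bold>\<top> p) {#} = 0"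
proof -
  let ?\<delta> = "\<lambda>h. if h = {#} then 1 else 0 :: real"
  have "lin_ext ?\<delta> (growth_forest f g) = 0" if "g \<noteq> {#}" for f g
    using that graft_nonempty by (simp add: lin_ext_growth_forest graft_sum_def)
  then have "lin_ext (\<lambda>g. lin_ext ?\<delta> (growth_forest f g)) p = 0" for f
    using lin_ext_primitive_cong[OF assms, of "\<lambda>g. lin_ext ?\<delta> (growth_forest f g)" "\<lambda>g. 0"]
    by simp
  then show ?thesis
    by (simp add: lookup_as_lin_ext lin_ext_natural_growth)
qed

text \<open>With \<open>\<Delta> f = \<Sum> f' \<otimes> f''\<close> this is \<open>\<Delta>(f \<^bold>\<top> p) = (f \<^bold>\<top> p) \<otimes> 1 + \<Sum> f' \<otimes> (f'' \<^bold>\<top> p)\<close>, the formula that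
  characterises appending a letter to a word. By the description of the cuts of a grafted
  forest, \<open>\<Delta>(f \<^bold>\<top> p)\<close> is the image of \<open>\<Delta> p\<close> under a linear map \<open>\<Theta>\<close>, and for primitive \<open>p\<close> only the
  two trivial cuts contribute.\<close>

lemma cut_sum_growth_primitive:
  assumes p: "p \<in> primitives"
  shows "lin_ext (cut_sum \<Psi>) (basis f \<^bold>\<top> p) =
    lin_ext (\<lambda>h. \<Psi> h {#}) (basis f \<^bold>\<top> p) + cut_sum (\<lambda>a b. lin_ext (\<Psi> a) (basis b \<^bold>\<top> p)) f"
proof -
  \<comment> \<open>The normalising weight of the forest grown onto is the sum of the weights of the two parts of a
    cut, and this makes \<open>\<Theta>\<close> a function of these parts alone.\<close>
  define \<Theta> where "\<Theta> b c = (1 / (real (weight b) + real (weight c))) *\<^sub>R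
     (graft_sum (\<lambda>h. \<Psi> h c) f b + cut_sum (\<lambda>a a'. graft_sum (\<lambda>h. \<Psi> (a + b) h) a' c) f)" for b c
  have "lin_ext (cut_sum \<Psi>) (growth_forest f g) = cut_sum \<Theta> g" if "g \<noteq> {#}" for g
  proof -
    have "lin_ext (cut_sum \<Psi>) (growth_forest f g) = (1 / real (weight g)) *\<^sub>R cut_sum (\<lambda>b c.
       graft_sum (\<lambda>h. \<Psi> h c) f b + cut_sum (\<lambda>a a'. graft_sum (\<lambda>h. \<Psi> (a + b) h) a' c) f) g"
      unfolding lin_ext_growth_forest[OF that] cut_sum_graft_sum ..
    also have "\<dots> = cut_sum \<Theta> g"
      unfolding cut_sum_fun_scale[symmetric] \<Theta>_def
      by (rule cut_sum_cong) (simp flip: of_nat_add)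
    finally show ?thesis .
  qed
  then have "lin_ext (cut_sum \<Psi>) (basis f \<^bold>\<top> p) = lin_ext (cut_sum \<Theta>) p"
    unfolding lin_ext_natural_growth lin_ext_basis by (rule lin_ext_primitive_cong[OF p])
  also have "\<dots> = lin_ext (\<lambda>g. \<Theta> g {#} + \<Theta> {#} g) p"
    by (rule primitive_cut_sum[OF p])
  also have "\<dots> = lin_ext (\<lambda>g. lin_ext (\<lambda>h. \<Psi> h {#}) (growth_forest f g) +
      cut_sum (\<lambda>a b. lin_ext (\<Psi> a) (growth_forest b g)) f) p"
    by (rule lin_ext_primitive_cong[OF p])
      (simp add: \<Theta>_def lin_ext_growth_forest cut_sum_fun_scale)
  also have "\<dots> = lin_ext (\<lambda>h. \<Psi> h {#}) (basis f \<^bold>\<top> p) +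
      cut_sum (\<lambda>a b. lin_ext (\<Psi> a) (basis b \<^bold>\<top> p)) f"
    by (simp add: lin_ext_fun_add lin_ext_natural_growth cut_sum_lin_ext_swap)
  finally show ?thesis .
qed

section \<open>The projection onto the primitive elements\<close>

text \<open>In the tensor coalgebra a nonempty word is the concatenation of a prefix with a single letter in
  exactly one way, hence the sum of \<open>F' \<^bold>\<top> \<pi>(F'')\<close> over the cuts of \<open>F\<close> must be \<open>F\<close> when
  \<open>F\<close> is nonempty. The term with empty \<open>F'\<close> is \<open>\<pi>(F)\<close>, which is solved for. The test on weights excludes just this term;
  it is stated in this form in order that termination is evident.\<close>

function primitive_part :: "forest \<Rightarrow> ck" where
  "primitive_part F = (if F = {#} then 0 else basis F -
     (\<Sum>A | descendant_closed F A.
        let a = restrict_forest F A; b = restrict_forest F (vertices F - A)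
        in if weight b < weight F then basis a \<^bold>\<top> primitive_part b else 0))"
  by pat_completeness auto
termination by (relation "Wellfounded.measure weight") auto

declare primitive_part.simps [simp del]

lemma primitive_part_empty [simp]: "primitive_part {#} = 0"
  by (subst primitive_part.simps) simp

lemma primitive_part_rec:
  assumes "F \<noteq> {#}"
  shows "primitive_part F = basis F -
    cut_sum (\<lambda>a b. if a = {#} then 0 else basis a \<^bold>\<top> primitive_part b) F"
proof -
  have "primitive_part F = basis F -
    cut_sum (\<lambda>a b. if weight b < weight F then basis a \<^bold>\<top> primitive_part b else 0) F"
    using assms by (subst primitive_part.simps) (simp add: cut_sum_def Let_def)
  also have "cut_sum (\<lambda>a b. if weight b < weight F then basis a \<^bold>\<top> primitive_part b else 0) F =
    cut_sum (\<lambda>a b. if a = {#} then 0 else basis a \<^bold>\<top> primitive_part b) F"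
    by (rule cut_sum_cong) (auto simp flip: weight_pos_iff)
  finally show ?thesis .
qed

lemma cut_sum_primitive_part:
  "cut_sum (\<lambda>a b. basis a \<^bold>\<top> primitive_part b) F = (if F = {#} then 0 else basis F)"
proof (cases "F = {#}")
  case False
  have "cut_sum (\<lambda>a b. basis a \<^bold>\<top> primitive_part b) F =
     cut_sum (\<lambda>a b. if a = {#} then 0 else basis a \<^bold>\<top> primitive_part b) F +
     cut_sum (\<lambda>a b. if a = {#} then primitive_part b else 0) F"
    unfolding cut_sum_fun_add[symmetric] by (rule cut_sum_cong) simp
  also have "\<dots> = basis F"
    using primitive_part_rec[OF False] by (simp add: cut_sum_counit_left)
  finally show ?thesis using False by simp
qed simp

text \<open>Let \<open>R = F - \<pi>(F)\<close> be the sum of \<open>F' \<^bold>\<top> \<pi>(F'')\<close> with \<open>F'\<close> nonempty. By induction the \<open>\<pi>(F'')\<close>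
  in it are primitive, so \<open>\<Delta> R\<close> is \<open>R \<otimes> 1\<close> plus the sum of \<open>F' \<otimes> (F'' \<^bold>\<top> \<pi>(F'''))\<close> in which
  \<open>F'\<close> and \<open>F''\<close> are not both empty. By coassociativity and the recursion for the part below \<open>F'\<close>, the
  unrestricted sum is \<open>\<Delta> F - F \<otimes> 1\<close>, and the excluded terms add up to \<open>1 \<otimes> \<pi>(F)\<close>.\<close>

lemma primitive_part_primitive: "primitive_part F \<in> primitives"
proof (induction "weight F" arbitrary: F rule: less_induct)
  case less
  show ?case
  proof (cases "F = {#}")
    case True
    then show ?thesis by (simp add: primitives_def tensor_def bilin_ext_def)
  next
    case F: False
    define R where "R = cut_sum (\<lambda>a b. if a = {#} then 0 else basis a \<^bold>\<top> primitive_part b) F"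
    have pR: "primitive_part F = basis F - R"
      unfolding R_def by (rule primitive_part_rec[OF F])
    define \<Psi> :: "forest \<Rightarrow> forest \<Rightarrow> (forest \<times> forest \<Rightarrow>\<^sub>0 real)" where "\<Psi> = (\<lambda>a b. basis (a, b))"
    define Y where "Y a b c = lin_ext (\<Psi> a) (basis b \<^bold>\<top> primitive_part c)" for a b c
    have R: "lin_ext \<phi> R = cut_sum (\<lambda>a b. if a = {#} then 0 else lin_ext \<phi> (basis a \<^bold>\<top> primitive_part b)) F"
      for \<phi> :: "forest \<Rightarrow> (forest \<times> forest \<Rightarrow>\<^sub>0 real)"
      unfolding R_def lin_ext_cut_sum by (rule cut_sum_cong) simp
    have "lin_ext (cut_sum \<Psi>) R = cut_sum (\<lambda>a b. (if a = {#} then 0 else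
        lin_ext (\<lambda>h. \<Psi> h {#}) (basis a \<^bold>\<top> primitive_part b)) +
        (cut_sum (\<lambda>c d. Y c d b) a - (if a = {#} then Y {#} {#} b else 0))) F"
      unfolding R
    proof (rule cut_sum_cong)
      fix a b assume w: "weight a + weight b = weight F"
      show "(if a = {#} then 0 else lin_ext (cut_sum \<Psi>) (basis a \<^bold>\<top> primitive_part b)) =
        (if a = {#} then 0 else lin_ext (\<lambda>h. \<Psi> h {#}) (basis a \<^bold>\<top> primitive_part b)) +
        (cut_sum (\<lambda>c d. Y c d b) a - (if a = {#} then Y {#} {#} b else 0))"
      proof (cases "a = {#}")
        case False
        then have "weight b < weight F" using w by (simp flip: weight_pos_iff)
        then show ?thesis
          using False cut_sum_growth_primitive[OF less.hyps, of b \<Psi> a] by (simp add: Y_def)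
      qed simp
    qed
    also have "\<dots> = lin_ext (\<lambda>h. \<Psi> h {#}) R +
        (cut_sum (\<lambda>a b. cut_sum (\<lambda>c d. Y c d b) a) F - Y {#} {#} F)"
      by (simp only: cut_sum_fun_add cut_sum_fun_diff R cut_sum_counit_left[of "Y {#} {#}"])
    also have "cut_sum (\<lambda>a b. cut_sum (\<lambda>c d. Y c d b) a) F =
        cut_sum (\<lambda>c e. lin_ext (\<Psi> c) (cut_sum (\<lambda>d b. basis d \<^bold>\<top> primitive_part b) e)) F"
      unfolding Y_def lin_ext_cut_sum by (rule cut_sum_coassoc)
    also have "\<dots> = cut_sum (\<lambda>c e. \<Psi> c e - (if e = {#} then \<Psi> c {#} else 0)) F"
      unfolding cut_sum_primitive_part by (rule cut_sum_cong) simp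
    also have "\<dots> = cut_sum \<Psi> F - \<Psi> F {#}"
      unfolding cut_sum_fun_diff cut_sum_counit_right[of "\<lambda>c. \<Psi> c {#}"] ..
    also have "Y {#} {#} F = \<Psi> {#} F - lin_ext (\<Psi> {#}) R"
      by (simp add: Y_def pR lin_ext_diff)
    finally have "lin_ext (cut_sum \<Psi>) (primitive_part F) =
        lin_ext (\<lambda>F. \<Psi> F {#} + \<Psi> {#} F) (primitive_part F)"
      by (simp add: pR lin_ext_diff lin_ext_fun_add algebra_simps)
    then show ?thesis unfolding \<Psi>_def by (rule primitiveI)
  qed
qed

text \<open>Apply the recursion for \<open>\<pi>\<close> to \<open>f \<^bold>\<top> p\<close>. Its coproduct gives \<open>f \<^bold>\<top> p = \<Sum> f' \<^bold>\<top> \<pi>(f'' \<^bold>\<top> p)\<close>; by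
  induction, among the terms with \<open>f'\<close> nonempty only the one with \<open>f''\<close> empty survives, and it already
  equals \<open>f \<^bold>\<top> p\<close> when \<open>f\<close> is nonempty.\<close>

lemma primitive_part_growth_forest:
  assumes p: "p \<in> primitives"
  shows "lin_ext primitive_part (basis f \<^bold>\<top> p) = (if f = {#} then p else 0)"
proof (induction "weight f" arbitrary: f rule: less_induct)
  case less
  let ?\<pi> = "\<lambda>f. lin_ext primitive_part (basis f \<^bold>\<top> p)"
  have nonempty: "Poly_Mapping.lookup (basis f \<^bold>\<top> p) {#} = 0"
    by (rule lookup_natural_growth_empty[OF p])
  have "lin_ext (cut_sum (\<lambda>a b. basis a \<^bold>\<top> primitive_part b)) (basis f \<^bold>\<top> p) =
     cut_sum (\<lambda>a b. lin_ext (\<lambda>h. basis a \<^bold>\<top> primitive_part h) (basis b \<^bold>\<top> p)) f"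
    unfolding cut_sum_growth_primitive[OF p] by simp
  also have "\<dots> = cut_sum (\<lambda>a b. basis a \<^bold>\<top> ?\<pi> b) f"
    by (simp add: linear_lin_ext_fun[OF linear_natural_growth_right])
  also have "\<dots> = cut_sum (\<lambda>a b. (if a = {#} then ?\<pi> b else 0) +
      (if b = {#} then (if a = {#} then 0 else basis a \<^bold>\<top> p) else 0)) f"
  proof (rule cut_sum_cong)
    fix a b assume w: "weight a + weight b = weight f"
    show "basis a \<^bold>\<top> ?\<pi> b = (if a = {#} then ?\<pi> b else 0) +
      (if b = {#} then (if a = {#} then 0 else basis a \<^bold>\<top> p) else 0)"
    proof (cases "a = {#}")
      case False
      then have "weight b < weight f" using w by (simp flip: weight_pos_iff)
      then show ?thesis using False less by simp
    qed simp
  qed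
  also have "\<dots> = ?\<pi> f + (if f = {#} then 0 else basis f \<^bold>\<top> p)"
    by (simp only: cut_sum_fun_add cut_sum_counit_left cut_sum_counit_right)
  finally have "?\<pi> f + (if f = {#} then 0 else basis f \<^bold>\<top> p) =
      lin_ext (\<lambda>h. if h = {#} then 0 else basis h) (basis f \<^bold>\<top> p)"
    by (simp add: cut_sum_primitive_part[abs_def])
  also have "\<dots> = lin_ext basis (basis f \<^bold>\<top> p)"
    using nonempty by (intro lin_ext_cong) (auto simp: in_keys_iff)
  finally show ?case by (auto split: if_splits)
qed

lemma primitive_part_growth:
  assumes "p \<in> primitives"
  shows "lin_ext primitive_part (x \<^bold>\<top> p) = Poly_Mapping.lookup x {#} *\<^sub>R p"
proof -
  have "lin_ext primitive_part (x \<^bold>\<top> p) = lin_ext (\<lambda>f. lin_ext primitive_part (basis f \<^bold>\<top> p)) x"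
    by (subst natural_growth_as_lin_ext) (rule lin_ext_lin_ext)
  also have "\<dots> = lin_ext (\<lambda>f. (if f = {#} then 1 else 0) *\<^sub>R p) x"
    unfolding primitive_part_growth_forest[OF assms] by (rule lin_ext_cong) simp
  also have "\<dots> = Poly_Mapping.lookup x {#} *\<^sub>R p"
    unfolding lookup_as_lin_ext by (rule linear_lin_ext_fun[symmetric]) (rule linear_scaleR_left)
  finally show ?thesis .
qed

lemma growth_word_Nil [simp]: "growth_word [] = basis {#}"
  by (simp add: growth_word_def)

lemma growth_word_snoc [simp]: "growth_word (ps @ [p]) = growth_word ps \<^bold>\<top> p"
  by (simp add: growth_word_def)

lemma is_word_projection_primitive_part: "is_word_projection primitive_part"
  unfolding is_word_projection_def
proof (intro allI impI)
  fix ps :: "ck list" assume ps: "set ps \<subseteq> primitives"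
  show "lin_ext primitive_part (growth_word ps) = (if length ps = 1 then hd ps else 0)"
  proof (cases ps rule: rev_cases)
    case (snoc qs p)
    have "Poly_Mapping.lookup (growth_word qs) {#} = (if qs = [] then 1 else 0)"
    proof (cases qs rule: rev_cases)
      case (snoc rs q)
      then show ?thesis
        using ps \<open>ps = qs @ [p]\<close> by (simp add: lookup_natural_growth_empty)
    qed simp
    then show ?thesis
      using ps snoc by (simp add: primitive_part_growth)
  qed simp
qed

text \<open>In \<open>F = \<Sum> F' \<^bold>\<top> \<pi>(F'')\<close> the factors \<open>F'\<close> of the nonzero terms have smaller weight, since
  \<open>\<pi>\<close> vanishes at the empty forest, and growing a word onto a
  primitive element is again a word.\<close>

lemma growth_words_span: "basis F \<in> span {growth_word ps |ps. set ps \<subseteq> primitives}"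
  (is "_ \<in> span ?W")
proof (induction "weight F" arbitrary: F rule: less_induct)
  case less
  have growth: "x \<^bold>\<top> p \<in> span ?W" if "x \<in> span ?W" "p \<in> primitives" for x p
  proof -
    have "(\<lambda>x. x \<^bold>\<top> p) ` ?W \<subseteq> ?W"
    proof clarify
      fix ps :: "ck list" assume "set ps \<subseteq> primitives"
      then show "\<exists>qs. growth_word ps \<^bold>\<top> p = growth_word qs \<and> set qs \<subseteq> primitives"
        using \<open>p \<in> primitives\<close> by (intro exI[of _ "ps @ [p]"]) simp
    qed
    then have "span ((\<lambda>x. x \<^bold>\<top> p) ` ?W) \<subseteq> span ?W" by (rule span_mono)
    moreover have "x \<^bold>\<top> p \<in> span ((\<lambda>x. x \<^bold>\<top> p) ` ?W)"
      using linear_span_image[OF linear_natural_growth_left, of p ?W] that(1) by blast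
    ultimately show ?thesis by blast
  qed
  show ?case
  proof (cases "F = {#}")
    case True
    then have "basis F \<in> ?W" by (intro CollectI exI[of _ "[]"]) simp
    then show ?thesis by (rule span_base)
  next
    case False
    have "basis F = cut_sum (\<lambda>a b. basis a \<^bold>\<top> primitive_part b) F"
      by (simp add: cut_sum_primitive_part False)
    also have "\<dots> = cut_sum (\<lambda>a b. if weight a < weight F then basis a \<^bold>\<top> primitive_part b else 0) F"
    proof (rule cut_sum_cong)
      fix a b assume "weight a + weight b = weight F"
      then have "b = {#}" if "\<not> weight a < weight F" using that by (simp flip: weight_eq_0_iff)
      then show "basis a \<^bold>\<top> primitive_part b =
          (if weight a < weight F then basis a \<^bold>\<top> primitive_part b else 0)"
        by auto
    qed
    also have "\<dots> \<in> span ?W"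
      unfolding cut_sum_def
      using less primitive_part_primitive by (intro span_sum) (auto intro: growth span_zero)
    finally show ?thesis .
  qed
qed

lemma prim_proj_eq_primitive_part: "prim_proj = primitive_part"
  unfolding prim_proj_def
proof (rule the_equality[of is_word_projection], rule is_word_projection_primitive_part)
  fix \<phi> assume \<phi>: "is_word_projection \<phi>"
  have "lin_ext \<phi> x = lin_ext primitive_part x"
    if "x \<in> span {growth_word ps |ps. set ps \<subseteq> primitives}" for x
  proof (rule linear_eq_on[OF linear_lin_ext linear_lin_ext that])
    fix x assume "x \<in> {growth_word ps |ps. set ps \<subseteq> primitives}"
    then show "lin_ext \<phi> x = lin_ext primitive_part x"
      using \<phi> is_word_projection_primitive_part by (auto simp: is_word_projection_def)
  qed
  from this[OF growth_words_span] show "\<phi> = primitive_part" by (simp add: fun_eq_iff)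
qed

section \<open>The quasi-shuffle Hopf algebra\<close>

lemma letter_mult_PowSuc [simp]: "letter_mult (PowSuc i) (PowSuc j) = PowSuc (Suc (i + j))"
  by (simp add: letter_mult_def)

lemma letter_mult_commute: "letter_mult a b = letter_mult b a"
  by (cases a; cases b) simp

lemma letter_mult_assoc: "letter_mult (letter_mult a b) c = letter_mult a (letter_mult b c)"
  by (cases a; cases b; cases c) simp

lemma lin_ext_append_letter:
  "lin_ext \<Psi> (append_letter x a) = lin_ext (\<lambda>w. \<Psi> (w @ [a])) x"
  by (simp add: append_letter_def lin_ext_lin_ext)

lemma quasi_shuffle_Nil_left [simp]: "quasi_shuffle [] v = basis v"
  by (subst quasi_shuffle.simps) simp

lemma quasi_shuffle_Nil_right [simp]: "quasi_shuffle u [] = basis u"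
  by (subst quasi_shuffle.simps) simp

lemma quasi_shuffle_snoc:
  "quasi_shuffle (u @ [a]) (v @ [b]) =
     append_letter (quasi_shuffle u (v @ [b])) a + append_letter (quasi_shuffle (u @ [a]) v) b +
     append_letter (quasi_shuffle u v) (letter_mult a b)"
  by (subst quasi_shuffle.simps) simp

lemma lin_ext_quasi_shuffle_snoc:
  "lin_ext \<Psi> (quasi_shuffle (u @ [a]) (v @ [b])) =
     lin_ext (\<lambda>w. \<Psi> (w @ [a])) (quasi_shuffle u (v @ [b])) +
     lin_ext (\<lambda>w. \<Psi> (w @ [b])) (quasi_shuffle (u @ [a]) v) +
     lin_ext (\<lambda>w. \<Psi> (w @ [letter_mult a b])) (quasi_shuffle u v)"
  by (simp add: quasi_shuffle_snoc lin_ext_add lin_ext_append_letter)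

lemma snoc_induct2 [case_names Nil_left Nil_right snoc]:
  assumes "\<And>v. P [] v" and "\<And>u. P u []"
    and "\<And>u a v b. P u (v @ [b]) \<Longrightarrow> P (u @ [a]) v \<Longrightarrow> P u v \<Longrightarrow> P (u @ [a]) (v @ [b])"
  shows "P u v"
proof (induction u arbitrary: v rule: rev_induct)
  case (snoc a u)
  note IH = snoc.IH
  show ?case by (induction v rule: rev_induct) (use assms IH in auto)
qed (rule assms(1))

lemma quasi_shuffle_commute: "quasi_shuffle u v = quasi_shuffle v u"
  by (induction u v rule: snoc_induct2)
    (simp_all add: quasi_shuffle_snoc letter_mult_commute ac_simps)

text \<open>Both sides are sums over the last letter of the product of three words, which is a product of the last
  letters of a nonempty selection of them; this gives seven terms that correspond by induction.\<close>

lemma quasi_shuffle_assoc: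
  "lin_ext (\<lambda>x. lin_ext \<Psi> (quasi_shuffle x w)) (quasi_shuffle u v) =
   lin_ext (\<lambda>x. lin_ext \<Psi> (quasi_shuffle u x)) (quasi_shuffle v w)"
proof (induction u v arbitrary: w \<Psi> rule: snoc_induct2)
  case (snoc u a v b w \<Psi>)
  note IH = snoc.IH
  show ?case
  proof (induction w arbitrary: \<Psi> rule: rev_induct)
    case (snoc c w \<Psi>)
    let ?L = "\<lambda>l u v w. lin_ext (\<lambda>x. lin_ext (\<lambda>w. \<Psi> (w @ [l])) (quasi_shuffle x w)) (quasi_shuffle u v)"
    let ?R = "\<lambda>l u v w. lin_ext (\<lambda>x. lin_ext (\<lambda>w. \<Psi> (w @ [l])) (quasi_shuffle u x)) (quasi_shuffle v w)"
    have "lin_ext (\<lambda>x. lin_ext \<Psi> (quasi_shuffle x (w @ [c]))) (quasi_shuffle (u @ [a]) (v @ [b])) =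
      ?L a u (v @ [b]) (w @ [c]) + ?L b (u @ [a]) v (w @ [c]) + ?L c (u @ [a]) (v @ [b]) w +
      ?L (letter_mult a b) u v (w @ [c]) + ?L (letter_mult a c) u (v @ [b]) w +
      ?L (letter_mult b c) (u @ [a]) v w + ?L (letter_mult a (letter_mult b c)) u v w"
      by (simp add: lin_ext_quasi_shuffle_snoc lin_ext_fun_add letter_mult_assoc ac_simps)
    also have "\<dots> =
      ?R a u (v @ [b]) (w @ [c]) + ?R b (u @ [a]) v (w @ [c]) + ?R c (u @ [a]) (v @ [b]) w +
      ?R (letter_mult a b) u v (w @ [c]) + ?R (letter_mult a c) u (v @ [b]) w +
      ?R (letter_mult b c) (u @ [a]) v w + ?R (letter_mult a (letter_mult b c)) u v w"
      by (simp only: IH snoc.IH)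
    also have "\<dots> = lin_ext (\<lambda>x. lin_ext \<Psi> (quasi_shuffle (u @ [a]) x)) (quasi_shuffle (v @ [b]) (w @ [c]))"
      by (simp add: lin_ext_quasi_shuffle_snoc lin_ext_fun_add ac_simps)
    finally show ?case .
  qed simp
qed simp_all

abbreviation qsh_mult :: "qsh \<Rightarrow> qsh \<Rightarrow> qsh" (infixl \<open>\<star>\<close> 70) where
  "x \<star> y \<equiv> bilin_ext quasi_shuffle x y"

lemma lin_ext_qsh_mult:
  "lin_ext \<Psi> (x \<star> y) = lin_ext (\<lambda>u. lin_ext (\<lambda>v. lin_ext \<Psi> (quasi_shuffle u v)) y) x"
  by (simp add: bilin_ext_def lin_ext_lin_ext)

lemma qsh_mult_commute: "x \<star> y = y \<star> x"
  unfolding bilin_ext_def by (subst lin_ext_swap) (simp add: quasi_shuffle_commute)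

lemma qsh_mult_assoc: "(x \<star> y) \<star> z = x \<star> (y \<star> z)"
proof -
  have "(x \<star> y) \<star> z = lin_ext (\<lambda>u. lin_ext (\<lambda>v. lin_ext (\<lambda>w.
      lin_ext (\<lambda>k. quasi_shuffle k w) (quasi_shuffle u v)) z) y) x"
    unfolding bilin_ext_def[of _ _ z] lin_ext_qsh_mult by (simp add: lin_ext_swap[of _ z])
  also have "\<dots> = lin_ext (\<lambda>u. lin_ext (\<lambda>v. lin_ext (\<lambda>w.
      lin_ext (\<lambda>k. quasi_shuffle u k) (quasi_shuffle v w)) z) y) x"
    using quasi_shuffle_assoc[of basis] by simp
  also have "\<dots> = x \<star> (y \<star> z)"
    by (simp add: bilin_ext_def lin_ext_lin_ext)
  finally show ?thesis .
qed

lemma qsh_mult_unit [simp]: "basis [] \<star> x = x" "x \<star> basis [] = x"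
proof -
  have "quasi_shuffle [] = basis" by (rule ext) simp
  then show "basis [] \<star> x = x" "x \<star> basis [] = x"
    by (simp_all add: bilin_ext_def)
qed

lemma quasi_shuffle_counit:
  "lin_ext (\<lambda>w. if w = [] then 1 else 0 :: real) (quasi_shuffle u v) =
     (if u = [] then 1 else 0) * (if v = [] then 1 else 0)"
  by (induction u v rule: snoc_induct2) (simp_all add: lin_ext_quasi_shuffle_snoc)

lemma lookup_qsh_mult_Nil:
  "Poly_Mapping.lookup (x \<star> y) [] = Poly_Mapping.lookup x [] * Poly_Mapping.lookup y []"
  unfolding lookup_as_lin_ext lin_ext_qsh_mult quasi_shuffle_counit
  by (simp only: lin_ext_fun_mult_left lin_ext_fun_mult_right)

text \<open>The deconcatenation coproduct, paired with the functional that is \<open>\<Psi> u v\<close> on \<open>u \<otimes> v\<close>.\<close>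

definition deconc_sum :: "(letter list \<Rightarrow> letter list \<Rightarrow> 'v::real_vector) \<Rightarrow> letter list \<Rightarrow> 'v" where
  "deconc_sum \<Psi> w = (\<Sum>i\<le>length w. \<Psi> (take i w) (drop i w))"

lemma deconc_sum_Nil [simp]: "deconc_sum \<Psi> [] = \<Psi> [] []"
  by (simp add: deconc_sum_def)

text \<open>The cocycle equation for appending a letter has the same form as that of grafting onto a new root,
  which is why the recursion \<open>[f] \<mapsto> f \<otimes> x\<close> defines a morphism of coalgebras.\<close>

lemma deconc_sum_snoc [simp]:
  "deconc_sum \<Psi> (w @ [a]) = deconc_sum (\<lambda>u v. \<Psi> u (v @ [a])) w + \<Psi> (w @ [a]) []"
  by (simp add: deconc_sum_def)

lemma deconc_sum_fun_add:
  "deconc_sum (\<lambda>u v. \<Phi> u v + \<Psi> u v) w = deconc_sum \<Phi> w + deconc_sum \<Psi> w"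
  by (simp add: deconc_sum_def sum.distrib)

lemma deconc_sum_lin_ext_swap:
  "lin_ext (\<lambda>k. deconc_sum (\<lambda>u v. \<Psi> k u v) w) x = deconc_sum (\<lambda>u v. lin_ext (\<lambda>k. \<Psi> k u v) x) w"
  by (simp add: deconc_sum_def lin_ext_fun_sum)

text \<open>Deconcatenation is multiplicative for the quasi-shuffle product: expand both sides along the last
  letters, which stay in the second factor unless that factor is empty.\<close>

lemma deconc_sum_quasi_shuffle:
  "lin_ext (deconc_sum \<Psi>) (quasi_shuffle u v) =
     deconc_sum (\<lambda>u1 u2. deconc_sum (\<lambda>v1 v2.
       lin_ext (\<lambda>x. lin_ext (\<Psi> x) (quasi_shuffle u2 v2)) (quasi_shuffle u1 v1)) v) u"
proof (induction u v arbitrary: \<Psi> rule: snoc_induct2)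
  case (snoc u a v b)
  then show ?case
    by (simp add: lin_ext_quasi_shuffle_snoc lin_ext_fun_add deconc_sum_fun_add ac_simps)
qed simp_all

lemma deconc_sum_qsh_mult:
  "lin_ext (deconc_sum \<Psi>) (x \<star> y) =
     lin_ext (deconc_sum (\<lambda>u1 u2. lin_ext (deconc_sum (\<lambda>v1 v2.
       lin_ext (\<lambda>x. lin_ext (\<Psi> x) (quasi_shuffle u2 v2)) (quasi_shuffle u1 v1))) y)) x"
  unfolding lin_ext_qsh_mult deconc_sum_quasi_shuffle
  by (simp add: deconc_sum_lin_ext_swap)

section \<open>Arborification\<close>

text \<open>Needed in order that the product over the multiset of trees of a forest is well defined.\<close>

interpretation qsh_mult: comp_fun_commute "(\<star>)"
proof
  show "(\<star>) y \<circ> (\<star>) x = (\<star>) x \<circ> (\<star>) y" for x y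
    by (simp add: fun_eq_iff qsh_mult_assoc[symmetric] qsh_mult_commute[of y])
qed

primrec arb_tree :: "rtree \<Rightarrow> qsh" where
  "arb_tree (Node F) = append_letter (fold_mset (\<star>) (basis []) (image_mset arb_tree F)) (PowSuc 0)"

definition arb :: "forest \<Rightarrow> qsh" where
  "arb F = fold_mset (\<star>) (basis []) (image_mset arb_tree F)"

lemma arb_empty [simp]: "arb {#} = basis []"
  by (simp add: arb_def)

lemma arb_add: "arb (add_mset (Node G) F) = append_letter (arb G) (PowSuc 0) \<star> arb F"
  by (simp add: arb_def)

lemma arb_tree_root: "arb {#Node G#} = append_letter (arb G) (PowSuc 0)"
  by (simp add: arb_add)

lemma arb_union: "arb (F + G) = arb F \<star> arb G"
  by (induction F rule: forest_induct) (simp_all add: arb_add qsh_mult_assoc)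

lemma lookup_append_letter_Nil [simp]: "Poly_Mapping.lookup (append_letter x a) [] = 0"
  by (simp add: lookup_as_lin_ext lin_ext_append_letter)

lemma lookup_arb_Nil: "Poly_Mapping.lookup (arb F) [] = (if F = {#} then 1 else 0)"
  by (induction F rule: forest_induct) (simp_all add: arb_add lookup_qsh_mult_Nil)

text \<open>The product of \<open>a \<otimes> c\<close> and \<open>b \<otimes> d\<close> is \<open>(a \<star> b) \<otimes> (c \<star> d)\<close>.\<close>

lemma tensor_qsh_mult:
  "lin_ext (\<lambda>u1. lin_ext (\<lambda>u2. lin_ext (\<lambda>v1. lin_ext (\<lambda>v2.
     lin_ext (\<lambda>x. lin_ext (\<Psi> x) (quasi_shuffle u2 v2)) (quasi_shuffle u1 v1)) d) b) c) a =
   lin_ext (\<lambda>x. lin_ext (\<Psi> x) (c \<star> d)) (a \<star> b)"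
proof -
  have "lin_ext (\<lambda>x. lin_ext (\<Psi> x) (c \<star> d)) (a \<star> b) =
    lin_ext (\<lambda>u1. lin_ext (\<lambda>v1. lin_ext (\<lambda>x. lin_ext (\<lambda>u2. lin_ext (\<lambda>v2.
      lin_ext (\<Psi> x) (quasi_shuffle u2 v2)) d) c) (quasi_shuffle u1 v1)) b) a"
    unfolding lin_ext_qsh_mult ..
  also have "\<dots> = lin_ext (\<lambda>u1. lin_ext (\<lambda>v1. lin_ext (\<lambda>u2. lin_ext (\<lambda>v2. lin_ext (\<lambda>x.
      lin_ext (\<Psi> x) (quasi_shuffle u2 v2)) (quasi_shuffle u1 v1)) d) c) b) a"
    by (simp only: lin_ext_swap[of _ c "quasi_shuffle _ _"] lin_ext_swap[of _ d "quasi_shuffle _ _"])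
  also have "\<dots> = lin_ext (\<lambda>u1. lin_ext (\<lambda>u2. lin_ext (\<lambda>v1. lin_ext (\<lambda>v2. lin_ext (\<lambda>x.
      lin_ext (\<Psi> x) (quasi_shuffle u2 v2)) (quasi_shuffle u1 v1)) d) b) c) a"
    by (subst (2) lin_ext_swap) (rule refl)
  finally show ?thesis by simp
qed

text \<open>Arborification respects coproducts: on trees because both cocycle equations agree, and on products
  because both coproducts are multiplicative.\<close>

lemma deconc_sum_arb:
  "lin_ext (deconc_sum \<Psi>) (arb F) = cut_sum (\<lambda>g h. lin_ext (\<lambda>u. lin_ext (\<Psi> u) (arb h)) (arb g)) F"
proof (induction F arbitrary: \<Psi> rule: forest_induct)
  case (add F G)
  have tree: "lin_ext (deconc_sum \<Psi>) (arb {#Node G#}) =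
      cut_sum (\<lambda>g h. lin_ext (\<lambda>u. lin_ext (\<Psi> u) (arb h)) (arb g)) {#Node G#}"
    for \<Psi> :: "letter list \<Rightarrow> letter list \<Rightarrow> 'a"
    by (simp add: cut_sum_tree arb_tree_root lin_ext_append_letter lin_ext_fun_add add.IH(2)[symmetric])
  have "lin_ext (deconc_sum \<Psi>) (arb ({#Node G#} + F)) =
    cut_sum (\<lambda>g' h'. lin_ext (\<lambda>u1. lin_ext (\<lambda>u2.
      cut_sum (\<lambda>g h. lin_ext (\<lambda>v1. lin_ext (\<lambda>v2.
        lin_ext (\<lambda>x. lin_ext (\<Psi> x) (quasi_shuffle u2 v2)) (quasi_shuffle u1 v1)) (arb h)) (arb g)) F)
      (arb h')) (arb g')) {#Node G#}"
    unfolding arb_union deconc_sum_qsh_mult add.IH(1) tree ..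
  also have "\<dots> = cut_sum (\<lambda>g' h'. cut_sum (\<lambda>g h. 
      lin_ext (\<lambda>x. lin_ext (\<Psi> x) (arb (h' + h))) (arb (g' + g))) F) {#Node G#}"
    by (simp only: cut_sum_lin_ext_swap tensor_qsh_mult arb_union)
  also have "\<dots> = cut_sum (\<lambda>g h. lin_ext (\<lambda>u. lin_ext (\<Psi> u) (arb h)) (arb g)) ({#Node G#} + F)"
    by (simp only: cut_sum_union)
  finally show ?case by simp
qed simp

lemma deconcatenation_eq_deconc_sum: "deconcatenation = deconc_sum (\<lambda>u v. basis (u, v))"
  by (simp add: fun_eq_iff deconcatenation_def deconc_sum_def)

lemma arborification_eq_arb: "arborification = arb"
  unfolding arborification_def
proof (rule the_equality)
  have "lin_ext deconcatenation (arb f) = lin_ext (\<lambda>(g, h). tensor (arb g) (arb h)) (ck_coproduct f)" for f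
    by (simp add: lin_ext_ck_coproduct deconcatenation_eq_deconc_sum deconc_sum_arb tensor_def bilin_ext_def)
  then show "ck_qsh_hopf_morphism arb \<and> (\<forall>f. arb {#Node f#} = append_letter (arb f) (PowSuc 0))"
    by (simp add: ck_qsh_hopf_morphism_def arb_union arb_tree_root lookup_arb_Nil)
next
  fix \<alpha> assume \<alpha>: "ck_qsh_hopf_morphism \<alpha> \<and> (\<forall>f. \<alpha> {#Node f#} = append_letter (\<alpha> f) (PowSuc 0))"
  have "\<alpha> f = arb f" for f
  proof (induction f rule: forest_induct)
    case empty
    then show ?case using \<alpha> by (simp add: ck_qsh_hopf_morphism_def)
  next
    case (add F G)
    have "\<alpha> ({#Node G#} + F) = \<alpha> {#Node G#} \<star> \<alpha> F"
      using \<alpha> unfolding ck_qsh_hopf_morphism_def by blast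
    then show ?case using \<alpha> add.IH by (simp add: arb_add)
  qed
  then show "\<alpha> = arb" by (rule ext)
qed

section \<open>Natural growth as concatenation\<close>

text \<open>A quasi-shuffle of two words contains one-letter words only if both words have at most one letter.
  Here the first word ends with \<open>PowSuc 0\<close>, and the result is this letter itself or its product with
  the only letter of the second word.\<close>

lemma lookup_qsh_mult_single_letter:
  "Poly_Mapping.lookup (append_letter x (PowSuc 0) \<star> y) [PowSuc k] =
     Poly_Mapping.lookup x [] *
       (case k of 0 \<Rightarrow> Poly_Mapping.lookup y [] | Suc j \<Rightarrow> Poly_Mapping.lookup y [PowSuc j])"
proof -
  let ?\<delta> = "\<lambda>w w'. if w' = w then 1 else 0 :: real"
  define w where "w = (case k of 0 \<Rightarrow> [] | Suc j \<Rightarrow> [PowSuc j])"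
  have key: "lin_ext (?\<delta> [PowSuc k]) (quasi_shuffle (u @ [PowSuc 0]) v) = ?\<delta> [] u * ?\<delta> w v" for u v
  proof (cases v rule: rev_cases)
    case Nil
    then show ?thesis by (auto simp: w_def split: nat.split)
  next
    case (snoc v' b)
    have "lin_ext (\<lambda>w. if w = [] \<and> P then 1 else 0 :: real) z =
        (if P then lin_ext (\<lambda>w. if w = [] then 1 else 0) z else 0)" for P and z :: qsh
      by simp
    then show ?thesis
      unfolding snoc lin_ext_quasi_shuffle_snoc
      by (cases b) (auto simp: quasi_shuffle_counit w_def split: nat.split)
  qed
  have "Poly_Mapping.lookup (append_letter x (PowSuc 0) \<star> y) [PowSuc k] =
      Poly_Mapping.lookup x [] * Poly_Mapping.lookup y w"
    unfolding lookup_as_lin_ext lin_ext_qsh_mult lin_ext_append_letter key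
    by (simp only: lin_ext_fun_mult_left lin_ext_fun_mult_right)
  then show ?thesis by (simp add: w_def split: nat.split)
qed

lemma isolated_vertices_Suc: "isolated_vertices (Suc k) = add_mset (Node {#}) (isolated_vertices k)"
  by (simp add: isolated_vertices_def)

lemma add_mset_eq_isolated_vertices_iff:
  "add_mset (Node G) F = isolated_vertices (Suc k) \<longleftrightarrow> G = {#} \<and> F = isolated_vertices k"
proof
  assume eq: "add_mset (Node G) F = isolated_vertices (Suc k)"
  have "Node G \<in># isolated_vertices (Suc k)"
    unfolding eq[symmetric] by simp
  then have "G = {#}" by (simp add: isolated_vertices_def split: if_splits)
  then show "G = {#} \<and> F = isolated_vertices k"
    using eq by (simp add: isolated_vertices_Suc)
qed (simp add: isolated_vertices_Suc)

text \<open>A tree with more than one vertex is sent to words with more than one letter, and so is a product with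
  such a tree. In a product of \<open>k + 1\<close> letters \<open>x\<close> all of them can be merged in one way.\<close>

lemma lookup_arb_single_letter:
  "Poly_Mapping.lookup (arb F) [PowSuc k] = (if F = isolated_vertices (Suc k) then 1 else 0)"
proof (induction F arbitrary: k rule: forest_induct)
  case empty
  then show ?case by (simp add: isolated_vertices_Suc lookup_single when_def)
next
  case (add F G)
  show ?case
    unfolding arb_add lookup_qsh_mult_single_letter add_mset_eq_isolated_vertices_iff
    by (cases k) (simp_all add: lookup_arb_Nil add.IH isolated_vertices_def)
qed

lemma graft_neq_isolated_vertices:
  assumes "v \<in> vertices g" and "f \<noteq> {#}"
  shows "graft f v g \<noteq> isolated_vertices k"
proof -
  obtain x p where v: "v = x # p" using assms(1) by (cases v) auto
  have "graft f p (branches (fst x)) \<noteq> {#}" using assms(2) by (cases p) auto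
  moreover have "Node (graft f p (branches (fst x))) \<in># graft f v g" unfolding v by simp
  ultimately show ?thesis by (auto simp: isolated_vertices_def split: if_splits)
qed

text \<open>Every forest that occurs in \<open>f \<^bold>\<top> p\<close> has an edge, unless \<open>f\<close> is empty.\<close>

lemma lookup_arb_growth_single_letter:
  assumes p: "p \<in> primitives"
  shows "lin_ext (\<lambda>h. Poly_Mapping.lookup (arb h) [a]) (basis f \<^bold>\<top> p) =
    (if f = {#} then lin_ext (\<lambda>h. Poly_Mapping.lookup (arb h) [a]) p else 0)"
proof (cases "f = {#}")
  case False
  obtain k where a: "a = PowSuc k" by (cases a)
  have "lin_ext (\<lambda>h. Poly_Mapping.lookup (arb h) [a]) (growth_forest f g) = 0" if "g \<noteq> {#}" for g
    using that False
    by (simp add: lin_ext_growth_forest graft_sum_def a lookup_arb_single_letter graft_neq_isolated_vertices)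
  then show ?thesis
    using False lin_ext_primitive_cong[OF p, of
        "\<lambda>g. lin_ext (\<lambda>h. Poly_Mapping.lookup (arb h) [a]) (growth_forest f g)" "\<lambda>_. 0"]
    unfolding lin_ext_natural_growth lin_ext_basis by simp
qed simp

text \<open>The coefficient of \<open>wa\<close> is that of \<open>w \<otimes> a\<close> in the deconcatenation, and arborification is a
  morphism of coalgebras.\<close>

lemma lookup_arb_snoc:
  "Poly_Mapping.lookup (arb F) (u @ [a]) =
     cut_sum (\<lambda>g h. Poly_Mapping.lookup (arb g) u * Poly_Mapping.lookup (arb h) [a]) F"
proof -
  let ?\<delta> = "\<lambda>w w'. if w' = w then 1 else 0 :: real"
  have counit: "deconc_sum (\<lambda>x y. if y = [] then \<Phi> x else 0) w = \<Phi> w"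
    for \<Phi> :: "letter list \<Rightarrow> real" and w
    by (cases w rule: rev_cases) (simp_all add: deconc_sum_def)
  have "deconc_sum (\<lambda>x y. ?\<delta> u x * ?\<delta> [a] y) w = ?\<delta> (u @ [a]) w" for w
  proof (cases w rule: rev_cases)
    case (snoc v b)
    have "(\<lambda>x y. ?\<delta> u x * ?\<delta> [a] (y @ [b])) =
        (\<lambda>x y. if y = [] then (if x = u \<and> a = b then 1 else 0) else 0)"
      by (auto simp: fun_eq_iff)
    then have "deconc_sum (\<lambda>x y. ?\<delta> u x * ?\<delta> [a] y) w =
        deconc_sum (\<lambda>x y. if y = [] then (if x = u \<and> a = b then 1 else 0) else 0) v"
      unfolding snoc deconc_sum_snoc by simp
    then show ?thesis unfolding counit by (simp add: snoc)
  qed simp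
  then have "deconc_sum (\<lambda>x y. ?\<delta> u x * ?\<delta> [a] y) = ?\<delta> (u @ [a])"
    by (rule ext)
  then have "Poly_Mapping.lookup (arb F) (u @ [a]) =
      lin_ext (deconc_sum (\<lambda>x y. ?\<delta> u x * ?\<delta> [a] y)) (arb F)"
    by (simp only: lookup_as_lin_ext)
  also have "\<dots> = cut_sum (\<lambda>g h. Poly_Mapping.lookup (arb g) u * Poly_Mapping.lookup (arb h) [a]) F"
    unfolding deconc_sum_arb by (simp only: lin_ext_fun_mult_left lin_ext_fun_mult_right lookup_as_lin_ext)
  finally show ?thesis .
qed

text \<open>The arborification of \<open>x \<^bold>\<top> p\<close> is the concatenation of that of \<open>x\<close> with the one-letter part of
  that of \<open>p\<close>: in the coproduct of \<open>x \<^bold>\<top> p\<close> only \<open>x \<otimes> p\<close> has a one-letter part in its second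
  factor.\<close>

lemma lookup_arb_growth:
  assumes p: "p \<in> primitives"
  shows "Poly_Mapping.lookup (lin_ext arb (x \<^bold>\<top> p)) (u @ [a]) =
    Poly_Mapping.lookup (lin_ext arb x) u * Poly_Mapping.lookup (lin_ext arb p) [a]"
proof -
  define \<Psi> where "\<Psi> g h = Poly_Mapping.lookup (arb g) u * Poly_Mapping.lookup (arb h) [a]" for g h
  let ?p = "lin_ext (\<lambda>h. Poly_Mapping.lookup (arb h) [a]) p"
  have "lin_ext (cut_sum \<Psi>) (basis f \<^bold>\<top> p) = Poly_Mapping.lookup (arb f) u * ?p" for f
  proof -
    have "lin_ext (cut_sum \<Psi>) (basis f \<^bold>\<top> p) =
        cut_sum (\<lambda>g h. if h = {#} then Poly_Mapping.lookup (arb g) u * ?p else 0) f"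
      unfolding cut_sum_growth_primitive[OF p] \<Psi>_def lin_ext_fun_mult_left
        lookup_arb_growth_single_letter[OF p]
      by (simp add: lookup_single if_distrib cong: if_cong)
    then show ?thesis by (simp only: cut_sum_counit_right)
  qed
  then have "lin_ext (cut_sum \<Psi>) (x \<^bold>\<top> p) = lin_ext (\<lambda>f. Poly_Mapping.lookup (arb f) u) x * ?p"
    by (subst natural_growth_as_lin_ext) (simp only: lin_ext_lin_ext lin_ext_fun_mult_right)
  then show ?thesis
    by (simp add: lookup_lin_ext lookup_arb_snoc \<Psi>_def[abs_def])
qed

text \<open>A forest differs from its primitive part by forests that have an edge, which contribute no one-letter
  words.\<close>

lemma lookup_arb_primitive_part:
  assumes "F \<noteq> {#}"
  shows "Poly_Mapping.lookup (lin_ext arb (primitive_part F)) [a] = Poly_Mapping.lookup (arb F) [a]"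
proof -
  have "cut_sum (\<lambda>b c. lin_ext (\<lambda>h. Poly_Mapping.lookup (arb h) [a])
      (if b = {#} then 0 else basis b \<^bold>\<top> primitive_part c)) F = cut_sum (\<lambda>b c. 0) F"
    by (rule cut_sum_cong) (simp add: lookup_arb_growth_single_letter[OF primitive_part_primitive])
  then show ?thesis
    by (simp only: lookup_lin_ext) (simp add: primitive_part_rec[OF assms] lin_ext_diff lin_ext_cut_sum)
qed

lemma arb_growth_power_primitive_part:
  "lin_ext arb (growth_power (primitive_part (isolated_vertices (Suc k))) n) =
     basis (replicate n (PowSuc k))"
proof (rule poly_mapping_eqI)
  fix w
  let ?q = "primitive_part (isolated_vertices (Suc k))"
  have snoc: "growth_power ?q (Suc n) = growth_power ?q n \<^bold>\<top> ?q" for n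
    unfolding growth_power_def replicate_append_same[symmetric] replicate.simps growth_word_snoc ..
  have letter: "Poly_Mapping.lookup (lin_ext arb ?q) [a] = (if a = PowSuc k then 1 else 0)" for a
  proof -
    obtain j where "a = PowSuc j" by (cases a)
    moreover have "isolated_vertices (Suc k) \<noteq> {#}" by (simp add: isolated_vertices_Suc)
    moreover have "isolated_vertices (Suc k) = isolated_vertices (Suc j) \<longleftrightarrow> k = j"
      by (metis isolated_vertices_def size_replicate_mset Suc_inject)
    ultimately show ?thesis by (simp add: lookup_arb_primitive_part lookup_arb_single_letter)
  qed
  show "Poly_Mapping.lookup (lin_ext arb (growth_power ?q n)) w =
      Poly_Mapping.lookup (basis (replicate n (PowSuc k))) w"
  proof (induction n arbitrary: w)
    case 0
    then show ?case by (simp add: growth_power_def)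
  next
    case (Suc n)
    show ?case
    proof (cases w rule: rev_cases)
      case Nil
      have "Poly_Mapping.lookup (lin_ext arb (growth_power ?q (Suc n))) [] =
          Poly_Mapping.lookup (growth_power ?q (Suc n)) {#}"
        by (simp add: lookup_lin_ext lookup_arb_Nil lookup_as_lin_ext[of _ "{#}"])
      then show ?thesis
        unfolding snoc Nil
        by (simp add: lookup_natural_growth_empty[OF primitive_part_primitive] lookup_single)
    next
      case (snoc v a)
      have "replicate (Suc n) (PowSuc k) = replicate n (PowSuc k) @ [PowSuc k]"
        by (simp add: replicate_append_same)
      then show ?thesis
        unfolding \<open>growth_power ?q (Suc n) = growth_power ?q n \<^bold>\<top> ?q\<close> snoc
          lookup_arb_growth[OF primitive_part_primitive] letter Suc.IH
        by (auto simp: lookup_single when_def)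
    qed
  qed
qed

section \<open>Newton's identities for the powers of a letter\<close>

text \<open>A functional on words that comes from a character of forests is multiplicative on those words
  that are images under arborification.\<close>

lemma character_quasi_shuffle:
  fixes Y :: "letter list \<Rightarrow> real"
  assumes mult: "\<And>f g. lin_ext Y (arb (f + g)) = lin_ext Y (arb f) * lin_ext Y (arb g)"
    and x: "lin_ext arb x = basis u" and y: "lin_ext arb y = basis v"
  shows "lin_ext Y (quasi_shuffle u v) = Y u * Y v"
proof -
  have "lin_ext Y (quasi_shuffle u v) = lin_ext Y (lin_ext arb x \<star> lin_ext arb y)"
    unfolding x y by (simp add: bilin_ext_def)
  also have "\<dots> = lin_ext (\<lambda>f. lin_ext (\<lambda>g. lin_ext Y (arb f \<star> arb g)) y) x"
    by (simp only: bilin_ext_def lin_ext_lin_ext lin_ext_swap[of _ y "arb _"])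
  also have "\<dots> = lin_ext (\<lambda>f. lin_ext (\<lambda>g. lin_ext Y (arb f) * lin_ext Y (arb g)) y) x"
    by (simp only: mult flip: arb_union)
  also have "\<dots> = lin_ext Y (lin_ext arb x) * lin_ext Y (lin_ext arb y)"
    by (simp only: lin_ext_fun_mult_left lin_ext_fun_mult_right lin_ext_lin_ext)
  finally show ?thesis unfolding x y by simp
qed

text \<open>The sum of the \<open>k + 1\<close> words that arise by inserting \<open>z\<close> into \<open>k\<close> copies of \<open>y\<close>. The recursion
  distinguishes whether \<open>z\<close> is inserted before the last copy of \<open>y\<close> or after it.\<close>

primrec insertions :: "letter \<Rightarrow> letter \<Rightarrow> nat \<Rightarrow> qsh" where
  "insertions y z 0 = basis [z]"
| "insertions y z (Suc k) = append_letter (insertions y z k) y + basis (replicate (Suc k) y @ [z])"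

lemma append_letter_add: "append_letter (x + x') a = append_letter x a + append_letter x' a"
  by (simp add: append_letter_def lin_ext_add)

lemma append_letter_basis [simp]: "append_letter (basis w) a = basis (w @ [a])"
  by (simp add: append_letter_def)

lemma append_letter_scale: "append_letter (c *\<^sub>R x) a = c *\<^sub>R append_letter x a"
  by (simp add: append_letter_def lin_ext_scale)

text \<open>The letter \<open>z\<close> is inserted into the word, or else multiplied with one of the \<open>y\<close>; the product
  then stands among the remaining \<open>k - 1\<close> copies.\<close>

lemma quasi_shuffle_replicate:
  "quasi_shuffle (replicate k y) [z] =
     insertions y z k + (case k of 0 \<Rightarrow> 0 | Suc j \<Rightarrow> insertions y (letter_mult y z) j)"
proof (induction k)
  case (Suc k)
  have "quasi_shuffle (replicate (Suc k) y) [z] =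
      append_letter (quasi_shuffle (replicate k y) [z]) y + basis (replicate (Suc k) y @ [z]) +
      basis (replicate k y @ [letter_mult y z])"
    using quasi_shuffle_snoc[of "replicate k y" y "[]" z] by (simp add: replicate_append_same)
  then show ?case
    unfolding Suc.IH by (cases k) (simp_all add: append_letter_add)
qed simp

lemma insertions_self: "insertions y y k = real (Suc k) *\<^sub>R basis (replicate (Suc k) y)"
proof (induction k)
  case (Suc k)
  have word: "replicate (Suc k) y @ [y] = replicate (Suc (Suc k)) y"
    by (simp add: replicate_append_same)
  show ?case
    unfolding insertions.simps(2) Suc.IH append_letter_scale append_letter_basis word
      of_nat_Suc[of "Suc k"] scaleR_add_left scaleR_one by (rule add.commute)
qed simp

text \<open>The \<open>n\<close>-th growth power evaluates like the elementary symmetric function \<open>e\<^sub>n\<close>, and the primitive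
  parts of isolated vertices evaluate like power sums. If \<open>s i\<close> is the value of the insertions of
  \<open>y\<^sup>i\<^sup>+\<^sup>1\<close> into the word with \<open>n - 1 - i\<close> copies of \<open>y\<close>, then each product of an
  \<open>e\<close> with a \<open>p\<close> is \<open>s i + s (i + 1)\<close>, and the alternating sum telescopes to \<open>s 0\<close>.\<close>

lemma newton_identity:
  fixes Y :: "letter list \<Rightarrow> real" and m n :: nat
  assumes mult: "\<And>f g. lin_ext Y (arb (f + g)) = lin_ext Y (arb f) * lin_ext Y (arb g)"
    and m: "m \<ge> 1"
  defines "e \<equiv> \<lambda>n. lin_ext Y (lin_ext arb (growth_power (primitive_part (isolated_vertices m)) n))"
    and "p \<equiv> \<lambda>i. lin_ext Y (lin_ext arb (primitive_part (isolated_vertices (m * i))))"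
  shows "real n * e n = (\<Sum>i = 1..n. (-1) ^ (i - 1) * e (n - i) * p i)"
proof (cases n)
  case (Suc N)
  obtain l where l: "m = Suc l" using m by (cases m) auto
  define y where "y = PowSuc l"
  define z where "z i = PowSuc (l + m * i)" for i
  define s where "s i = lin_ext Y (insertions y (z i) (N - i))" for i
  have word: "lin_ext arb (growth_power (primitive_part (isolated_vertices m)) k) = basis (replicate k y)" for k
    unfolding l y_def by (rule arb_growth_power_primitive_part)
  have letter: "lin_ext arb (primitive_part (isolated_vertices (m * Suc i))) = basis [z i]" for i
    using arb_growth_power_primitive_part[of "l + m * i" 1]
    by (simp add: l z_def growth_power_def growth_word_def)
  have e: "e k = Y (replicate k y)" for k
    by (simp add: e_def word)
  have p: "p (Suc i) = Y [z i]" for i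
    unfolding p_def letter by simp
  have ep: "e (N - i) * p (Suc i) = s i + (if i < N then s (Suc i) else 0)" if "i \<le> N" for i
  proof -
    have "e (N - i) * p (Suc i) = lin_ext Y (quasi_shuffle (replicate (N - i) y) [z i])"
      unfolding e p by (rule character_quasi_shuffle[OF mult word letter, symmetric])
    also have "letter_mult y (z i) = z (Suc i)"
      by (simp add: y_def z_def l)
    then have "lin_ext Y (quasi_shuffle (replicate (N - i) y) [z i]) = s i + (if i < N then s (Suc i) else 0)"
      using that by (cases "N - i")
        (auto simp: quasi_shuffle_replicate lin_ext_add s_def diff_Suc simp del: replicate.simps insertions.simps)
    finally show ?thesis .
  qed
  \<comment> \<open>The signed summands, continued by zero since with no copy of \<open>y\<close> left there is nothing to merge
    with.\<close>
  define f where "f i = (if i \<le> N then (-1) ^ i * s i else 0)" for i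
  have "(\<Sum>i = 1..n. (-1) ^ (i - 1) * e (n - i) * p i) = (\<Sum>i<n. (-1) ^ i * (e (N - i) * p (Suc i)))"
    unfolding Suc by (rule sum.reindex_bij_witness[of _ Suc "\<lambda>i. i - 1"]) auto
  also have "\<dots> = (\<Sum>i<n. f i - f (Suc i))"
  proof (intro sum.cong refl)
    fix i assume "i \<in> {..<n}"
    then have i: "i \<le> N" by (simp add: Suc)
    show "(-1) ^ i * (e (N - i) * p (Suc i)) = f i - f (Suc i)"
      unfolding ep[OF i] using i by (simp add: f_def algebra_simps)
  qed
  also have "\<dots> = f 0 - f n"
    by (rule sum_lessThan_telescope')
  also have "\<dots> = real n * e n"
  proof -
    have "z 0 = y" by (simp add: z_def y_def)
    then show ?thesis
      by (simp add: f_def s_def Suc insertions_self lin_ext_scale e del: replicate.simps of_nat_Suc)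
  qed
  finally show ?thesis ..
qed simp

section \<open>The cycle index\<close>

text \<open>The number \<open>a i\<close> counts the cycles of length \<open>i\<close> of a permutation of \<open>n\<close> points. The bound \<open>N\<close> on
  the length of cycles is kept apart from \<open>n\<close>, so that the domain of \<open>a\<close> is the same for all \<open>n \<le> N\<close> and
  a recursion over \<open>n\<close> is possible.\<close>

definition cycle_types :: "nat \<Rightarrow> nat \<Rightarrow> (nat \<Rightarrow> nat) set" where
  "cycle_types N n = {a \<in> {1..N} \<rightarrow>\<^sub>E UNIV. (\<Sum>i = 1..N. i * a i) = n}"

definition cycle_index :: "(nat \<Rightarrow> real) \<Rightarrow> nat \<Rightarrow> nat \<Rightarrow> real" where
  "cycle_index x N n = (\<Sum>a\<in>cycle_types N n. \<Prod>i = 1..N. (x i / real i) ^ a i / fact (a i))"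

lemma finite_cycle_types: "finite (cycle_types N n)"
proof (rule finite_subset)
  show "cycle_types N n \<subseteq> {1..N} \<rightarrow>\<^sub>E {..n}"
  proof
    fix a assume a: "a \<in> cycle_types N n"
    have "a i \<le> n" if i: "i \<in> {1..N}" for i
    proof -
      have "a i \<le> i * a i" using i by simp
      also have "\<dots> \<le> (\<Sum>i = 1..N. i * a i)" using i by (intro member_le_sum) auto
      finally show ?thesis using a by (simp add: cycle_types_def)
    qed
    then show "a \<in> {1..N} \<rightarrow>\<^sub>E {..n}"
      using a by (auto simp: cycle_types_def PiE_iff)
  qed
qed (simp add: finite_PiE)

lemma cycle_index_0: "cycle_index x N 0 = 1"
proof -
  have "cycle_types N 0 = {\<lambda>i\<in>{1..N}. 0}"
    by (auto simp: cycle_types_def PiE_iff extensional_def fun_eq_iff)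
  then show ?thesis by (simp add: cycle_index_def)
qed

text \<open>Write \<open>n\<close> as \<open>\<Sum> i a\<^sub>i\<close> and remove one cycle of length \<open>i\<close>; the factor \<open>i a\<^sub>i\<close> is just what
  turns the term of \<open>a\<close> into \<open>x\<^sub>i\<close> times that of the remaining cycle type.\<close>

lemma cycle_index_rec:
  assumes "n \<le> N"
  shows "real n * cycle_index x N n = (\<Sum>i = 1..n. x i * cycle_index x N (n - i))"
proof -
  define t where "t i k = (x i / real i) ^ k / fact k" for i k
  define T where "T a = (\<Prod>i = 1..N. t i (a i))" for a
  have C: "cycle_index x N k = sum T (cycle_types N k)" for k
    by (simp add: cycle_index_def T_def t_def)
  have step: "(\<Sum>a\<in>cycle_types N n. real (i * a i) * T a) =
      (if i \<le> n then x i * cycle_index x N (n - i) else 0)" if i: "i \<in> {1..N}" for i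
  proof -
    have split: "(\<Sum>j = 1..N. j * (a :: nat \<Rightarrow> nat) j) = i * a i + (\<Sum>j\<in>{1..N} - {i}. j * a j)" for a
      using i by (subst sum.remove[of _ i]) auto
    have update: "a(i := c) \<in> cycle_types N k \<longleftrightarrow> i * c + (\<Sum>j\<in>{1..N} - {i}. j * a j) = k"
      if "a \<in> cycle_types N l" for a c k l
    proof -
      have "a(i := c) \<in> {1..N} \<rightarrow>\<^sub>E UNIV"
        using that i by (auto simp: cycle_types_def PiE_iff extensional_def)
      moreover have "(\<Sum>j\<in>{1..N} - {i}. j * (a(i := c)) j) = (\<Sum>j\<in>{1..N} - {i}. j * a j)"
        by (intro sum.cong) auto
      ultimately show ?thesis unfolding cycle_types_def split by simp
    qed
    have total: "i * a i + (\<Sum>j\<in>{1..N} - {i}. j * a j) = k" if "a \<in> cycle_types N k" for a k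
      using that unfolding cycle_types_def split by simp
    have Tsplit: "T a = t i (a i) * (\<Prod>j\<in>{1..N} - {i}. t j (a j))" for a
      unfolding T_def using i by (subst prod.remove[of _ i]) auto
    have "(\<Sum>a\<in>cycle_types N n. real (i * a i) * T a) =
        (\<Sum>a\<in>{a \<in> cycle_types N n. 0 < a i}. real (i * a i) * T a)"
      by (rule sum.mono_neutral_right) (auto simp: finite_cycle_types)
    also have "\<dots> = (if i \<le> n then x i * cycle_index x N (n - i) else 0)"
    proof (cases "i \<le> n")
      case True
      have "(\<Sum>a\<in>{a \<in> cycle_types N n. 0 < a i}. real (i * a i) * T a) =
          (\<Sum>a\<in>cycle_types N (n - i). x i * T a)"
      proof (rule sum.reindex_bij_witness[of _ "\<lambda>a. a(i := Suc (a i))" "\<lambda>a. a(i := a i - 1)"])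
        fix a assume a: "a \<in> {a \<in> cycle_types N n. 0 < a i}"
        then obtain k where k: "a i = Suc k" by (cases "a i") auto
        show "(a(i := a i - 1))(i := Suc ((a(i := a i - 1)) i)) = a"
          using k by auto
        show "a(i := a i - 1) \<in> cycle_types N (n - i)"
          using a k total[of a n] update[of a n "a i - 1"] by auto
        have "real (i * Suc k) * t i (Suc k) = x i * t i k"
        proof -
          have regroup: "A * B * (r * R / D) = (A * r) * (B * (R / D))" for A B r R D :: real
            by simp
          have "real (i * Suc k) * t i (Suc k) =
              (real i * (x i / real i)) * (real (Suc k) * ((x i / real i) ^ k / (real (Suc k) * fact k)))"
            unfolding t_def fact_Suc power_Suc of_nat_mult by (rule regroup)
          also have "real i * (x i / real i) = x i" using i by simp
          also have "real (Suc k) * ((x i / real i) ^ k / (real (Suc k) * fact k)) = t i k"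
            by (simp add: t_def del: of_nat_Suc)
          finally show ?thesis .
        qed
        then show "x i * T (a(i := a i - 1)) = real (i * a i) * T a"
          unfolding Tsplit by (simp add: k)
      next
        fix a assume a: "a \<in> cycle_types N (n - i)"
        show "(a(i := Suc (a i)))(i := (a(i := Suc (a i))) i - 1) = a" by auto
        show "a(i := Suc (a i)) \<in> {a \<in> cycle_types N n. 0 < a i}"
          using a True total[OF a] update[OF a, of "Suc (a i)"] by simp
      qed
      then show ?thesis using True by (simp add: C sum_distrib_left)
    next
      case False
      have "\<not> 0 < a i" if "a \<in> cycle_types N n" for a
      proof
        assume "0 < a i"
        then have "i \<le> i * a i" by simp
        also have "\<dots> \<le> n" using total[OF that] by linarith
        finally show False using False by simp
      qed
      then have "{a \<in> cycle_types N n. 0 < a i} = {}" by blast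
      then show ?thesis using False by (simp only: sum.empty if_False)
    qed
    finally show ?thesis .
  qed
  have "real n * cycle_index x N n = (\<Sum>a\<in>cycle_types N n. \<Sum>i = 1..N. real (i * a i) * T a)"
    unfolding C sum_distrib_left
  proof (intro sum.cong refl)
    fix a assume "a \<in> cycle_types N n"
    then have "n = (\<Sum>i = 1..N. i * a i)" by (simp add: cycle_types_def)
    then show "real n * T a = (\<Sum>i = 1..N. real (i * a i) * T a)"
      by (simp only: of_nat_sum sum_distrib_right)
  qed
  also have "\<dots> = (\<Sum>i = 1..N. if i \<le> n then x i * cycle_index x N (n - i) else 0)"
    by (subst sum.swap) (simp only: step cong: sum.cong)
  also have "\<dots> = (\<Sum>i = 1..n. x i * cycle_index x N (n - i))"
    using assms by (intro sum.mono_neutral_cong_right) auto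
  finally show ?thesis .
qed

text \<open>Up to the signs \<open>(-1)\<^sup>n\<close>, Newton's identity is the recursion of the cycle index at the negated
  power sums, and such a recursion has only one solution.\<close>

lemma newton_cycle_index:
  fixes e p :: "nat \<Rightarrow> real"
  assumes "e 0 = 1"
    and newton: "\<And>n. real n * e n = (\<Sum>i = 1..n. (-1) ^ (i - 1) * e (n - i) * p i)"
    and "n \<le> N"
  shows "e n = (-1) ^ n * cycle_index (\<lambda>i. - p i) N n"
  using \<open>n \<le> N\<close>
proof (induction n rule: less_induct)
  case (less n)
  let ?C = "cycle_index (\<lambda>i. - p i) N"
  show ?case
  proof (cases "n = 0")
    case False
    have "real n * e n = (\<Sum>i = 1..n. (-1) ^ n * (- p i * ?C (n - i)))"
      unfolding newton
    proof (intro sum.cong refl)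
      fix i assume i: "i \<in> {1..n}"
      then have IH: "e (n - i) = (-1) ^ (n - i) * ?C (n - i)" using less by simp
      have sign: "(-1 :: real) ^ (i - 1) * (-1) ^ (n - i) = - ((-1) ^ n)"
      proof -
        have "(-1 :: real) ^ (i - 1) * (-1) ^ (n - i) = - ((-1) ^ Suc ((i - 1) + (n - i)))"
          by (simp add: power_add)
        also have "Suc ((i - 1) + (n - i)) = n" using i by simp
        finally show ?thesis .
      qed
      have "(-1) ^ (i - 1) * e (n - i) * p i = ((-1) ^ (i - 1) * (-1) ^ (n - i)) * ?C (n - i) * p i"
        unfolding IH by (simp only: mult.assoc)
      then show "(-1) ^ (i - 1) * e (n - i) * p i = (-1) ^ n * (- p i * ?C (n - i))"
        unfolding sign by simp
    qed
    also have "\<dots> = real n * ((-1) ^ n * ?C n)"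
      unfolding sum_distrib_left[symmetric] cycle_index_rec[OF less.prems, symmetric]
      by (rule mult.left_commute)
    finally show ?thesis using False by simp
  qed (simp add: assms(1) cycle_index_0)
qed

section \<open>Signatures of growth powers\<close>

theorem corollary4p2:
  fixes \<rho> T s t :: real and \<omega> :: "real \<Rightarrow> real \<Rightarrow> real"
    and X \<X> :: "real \<Rightarrow> real \<Rightarrow> forest \<Rightarrow> real" and m n :: nat
  assumes "branched_rough_path \<rho> T \<omega> X"
    and "is_signature \<rho> T \<omega> X \<X>"
    and "quasi_geometric T \<X>"
    and "0 \<le> s" and "s \<le> t" and "t \<le> T"
    and "m \<ge> 1" and "n \<ge> 1"
  shows "lin_ext (\<X> s t) (growth_power (prim_proj (isolated_vertices m)) n) =
    (-1) ^ n *
    (\<Sum>a \<in> {a \<in> {1..n} \<rightarrow>\<^sub>E (UNIV :: nat set). (\<Sum>i = 1..n. i * a i) = n}.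
       (-1) ^ (\<Sum>i = 1..n. a i) / (\<Prod>i = 1..n. real (i ^ a i) * fact (a i))
       * (\<Prod>i = 1..n. lin_ext (\<X> s t) (prim_proj (isolated_vertices (m * i))) ^ a i))"
proof -
  obtain Y where "\<And>f. \<X> s t f = lin_ext Y (arborification f)"
    using assms(3-6) unfolding quasi_geometric_def by blast
  then have Y: "\<X> s t = (\<lambda>f. lin_ext Y (arb f))"
    by (simp add: fun_eq_iff arborification_eq_arb)
  have "\<X> s t {#} = 1" and "\<X> s t (f + g) = \<X> s t f * \<X> s t g" for f g
    using assms(2,4-6) unfolding is_signature_def rough_on_def by auto
  then have unit: "Y [] = 1"
    and mult: "lin_ext Y (arb (f + g)) = lin_ext Y (arb f) * lin_ext Y (arb g)" for f g
    by (simp_all add: Y)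
  define e where "e k = lin_ext (\<X> s t) (growth_power (primitive_part (isolated_vertices m)) k)" for k
  define p where "p i = lin_ext (\<X> s t) (primitive_part (isolated_vertices (m * i)))" for i
  have "real k * e k = (\<Sum>i = 1..k. (-1) ^ (i - 1) * e (k - i) * p i)" for k
    using newton_identity[OF mult assms(7)] by (simp add: e_def p_def Y lin_ext_lin_ext)
  moreover have "e 0 = 1"
    by (simp add: e_def growth_power_def Y unit)
  ultimately have "e n = (-1) ^ n * cycle_index (\<lambda>i. - p i) n n"
    by (intro newton_cycle_index) auto
  also have "cycle_index (\<lambda>i. - p i) n n = (\<Sum>a\<in>cycle_types n n.
      (-1) ^ (\<Sum>i = 1..n. a i) / (\<Prod>i = 1..n. real (i ^ a i) * fact (a i)) * (\<Prod>i = 1..n. p i ^ a i))"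
    unfolding cycle_index_def
  proof (intro sum.cong refl)
    fix a
    have "(- p i / real i) ^ a i / fact (a i) = (-1) ^ a i / (real (i ^ a i) * fact (a i)) * p i ^ a i" for i
      by (simp add: power_divide power_minus[of "p i / real i"])
    then show "(\<Prod>i = 1..n. (- p i / real i) ^ a i / fact (a i)) =
      (-1) ^ (\<Sum>i = 1..n. a i) / (\<Prod>i = 1..n. real (i ^ a i) * fact (a i)) * (\<Prod>i = 1..n. p i ^ a i)"
      by (simp only: power_sum prod_dividef prod.distrib)
  qed
  finally show ?thesis
    unfolding e_def p_def cycle_types_def prim_proj_eq_primitive_part .
qed

end
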